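(* Let $D_1$ and $D_2$ be bounded domains in $\mathbb{C}^n$, $n\ge 1$, and let $\phi\colon D_1\to D_2$ be a proper holomorphic map of finite multiplicity. If $D_1$ is circular, $0\in D_1$, and the complex Jacobian $J\phi$ is a homogeneous polynomial, then the Friedrichs operator of $D_2$ is of rank one.
   Context: For a domain $D\subset\mathbb{C}^n$, the Bergman space $A^2(D)$ is the closed subspace of $L^2(D)$ (with respect to Lebesgue measure, with inner product $\langle f,g\rangle=\int_D f\bar g\,dV$) consisting of holomorphic functions. The Bergman projection $B_D$ is the orthogonal projection of $L^2(D)$ onto $A^2(D)$. The Friedrichs operator of $D$ is the (conjugate-linear) map $F_D\colon A^2(D)\to A^2(D)$, $F_D(g)=B_D(\bar g)$. It is of rank one if its range is a one-dimensional complex vector space. A domain $D\subset\mathbb{C}^n$ is circular if $e^{i\theta}z\in D$ for every $z\in D$ and $\theta\in\mathbb{R}$. The complex Jacobian $J\phi$ is the determinant of the complex derivative matrix of $\phi$. The multiplicity of a proper holomorphic map $\phi\colon D_1\to D_2$ is the number of preimages of a point of $D_2$ that is not a critical value of $\phi$. *)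

theory Defs
  imports "HOL-Analysis.Analysis" "HOL-Library.Function_Algebras"
begin

definition complex_domain :: "(complex^'n) set \<Rightarrow> bool" where
  "complex_domain D \<longleftrightarrow> open D \<and> connected D \<and> D \<noteq> {}"

definition circular :: "(complex^'n) set \<Rightarrow> bool" where
  "circular D \<longleftrightarrow> (\<forall>z\<in>D. \<forall>\<theta>::real. exp (\<i> * of_real \<theta>) *s z \<in> D)"

definition holomorphic_fun_on :: "(complex^'n \<Rightarrow> complex) \<Rightarrow> (complex^'n) set \<Rightarrow> bool" where
  "holomorphic_fun_on f D \<longleftrightarrow>
     (\<forall>z\<in>D. \<exists>f'. (f has_derivative f') (at z) \<and> (\<forall>c v. f' (c *s v) = c * f' v))"

definition holomorphic_map_on :: "(complex^'n \<Rightarrow> complex^'m) \<Rightarrow> (complex^'n) set \<Rightarrow> bool" where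
  "holomorphic_map_on \<phi> D \<longleftrightarrow> (\<forall>i. holomorphic_fun_on (\<lambda>z. \<phi> z $ i) D)"

text \<open>The library's \<^const>\<open>frechet_derivative\<close> is the derivative over the reals. For a
  holomorphic map it is complex linear, and \<^const>\<open>jacobian\<close>, whose columns are the images of the
  unit vectors \<open>axis j 1\<close>, is its complex matrix \<open>\<partial>\<phi>\<^sub>i/\<partial>z\<^sub>j\<close>.\<close>

definition complex_jacobian :: "(complex^'n \<Rightarrow> complex^'n) \<Rightarrow> complex^'n \<Rightarrow> complex" where
  "complex_jacobian \<phi> z = det (jacobian \<phi> (at z))"

definition homogeneous_polynomial :: "nat \<Rightarrow> (complex^'n \<Rightarrow> complex) \<Rightarrow> bool" where
  "homogeneous_polynomial d p \<longleftrightarrow>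
     (\<exists>c :: ('n \<Rightarrow> nat) \<Rightarrow> complex.
        \<forall>z. p z = (\<Sum>\<alpha> | (\<Sum>i\<in>UNIV. \<alpha> i) = d. c \<alpha> * (\<Prod>i\<in>UNIV. (z $ i) ^ \<alpha> i)))"

text \<open>The index set of the sum above is finite, so the sum does not degenerate to \<open>0\<close>.\<close>

lemma finite_multi_indices: "finite {\<alpha> :: 'n::finite \<Rightarrow> nat. (\<Sum>i\<in>UNIV. \<alpha> i) = d}"
proof (rule finite_subset)
  show "{\<alpha> :: 'n \<Rightarrow> nat. (\<Sum>i\<in>UNIV. \<alpha> i) = d} \<subseteq> Pi\<^sub>E UNIV (\<lambda>_. {..d})"
    using member_le_sum[of _ "UNIV :: 'n set"] by fastforce
  show "finite (Pi\<^sub>E (UNIV :: 'n set) (\<lambda>_. {..d}))"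
    by (intro finite_PiE) auto
qed

definition critical_values ::
    "(complex^'n \<Rightarrow> complex^'n) \<Rightarrow> (complex^'n) set \<Rightarrow> (complex^'n) set" where
  "critical_values \<phi> D = \<phi> ` {z \<in> D. complex_jacobian \<phi> z = 0}"

definition proper_holomorphic_map ::
    "(complex^'n) set \<Rightarrow> (complex^'m) set \<Rightarrow> (complex^'n \<Rightarrow> complex^'m) \<Rightarrow> bool" where
  "proper_holomorphic_map D\<^sub>1 D\<^sub>2 \<phi> \<longleftrightarrow>
     \<phi> \<in> D\<^sub>1 \<rightarrow> D\<^sub>2 \<and> holomorphic_map_on \<phi> D\<^sub>1 \<and> proper_map (top_of_set D\<^sub>1) (top_of_set D\<^sub>2) \<phi>"

text \<open>\<^const>\<open>proper_map\<close> means closed with compact fibres; for continuous maps between subsets of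
  Euclidean spaces this is the usual condition on preimages of compact sets.\<close>

lemma proper_map_iff_compact_preimage:
  fixes \<phi> :: "complex^'n \<Rightarrow> complex^'m"
  assumes "continuous_on D\<^sub>1 \<phi>" "\<phi> \<in> D\<^sub>1 \<rightarrow> D\<^sub>2"
  shows "proper_map (top_of_set D\<^sub>1) (top_of_set D\<^sub>2) \<phi> \<longleftrightarrow>
           (\<forall>K. compact K \<and> K \<subseteq> D\<^sub>2 \<longrightarrow> compact {z \<in> D\<^sub>1. \<phi> z \<in> K})"
proof
  assume "proper_map (top_of_set D\<^sub>1) (top_of_set D\<^sub>2) \<phi>"
  from compactin_proper_map_preimage[OF this]
  show "\<forall>K. compact K \<and> K \<subseteq> D\<^sub>2 \<longrightarrow> compact {z \<in> D\<^sub>1. \<phi> z \<in> K}"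
    by (auto simp: compactin_subtopology)
next
  assume *: "\<forall>K. compact K \<and> K \<subseteq> D\<^sub>2 \<longrightarrow> compact {z \<in> D\<^sub>1. \<phi> z \<in> K}"
  show "proper_map (top_of_set D\<^sub>1) (top_of_set D\<^sub>2) \<phi>"
  proof (rule compact_imp_proper_map)
    show "k_space (top_of_set D\<^sub>2)"
      by (intro metrizable_imp_k_space metrizable_space_subtopology metrizable_space_euclidean)
    show "kc_space (top_of_set D\<^sub>2)"
      by (intro Hausdorff_imp_kc_space Hausdorff_space_subtopology) simp
    show "\<phi> \<in> topspace (top_of_set D\<^sub>1) \<rightarrow> topspace (top_of_set D\<^sub>2)" using assms by simp
    show "continuous_map (top_of_set D\<^sub>1) (top_of_set D\<^sub>2) \<phi> \<or> kc_space (top_of_set D\<^sub>1)"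
      by (intro disjI2 Hausdorff_imp_kc_space Hausdorff_space_subtopology) simp
    fix K assume "compactin (top_of_set D\<^sub>2) K"
    then show "compactin (top_of_set D\<^sub>1) {x \<in> topspace (top_of_set D\<^sub>1). \<phi> x \<in> K}"
      using * by (auto simp: compactin_subtopology)
  qed
qed

text \<open>That the number of preimages is the same for all noncritical values is part of the notion of
  multiplicity. Critical values are images of points where the complex Jacobian vanishes.\<close>

definition has_multiplicity ::
    "(complex^'n) set \<Rightarrow> (complex^'n) set \<Rightarrow> (complex^'n \<Rightarrow> complex^'n) \<Rightarrow> nat \<Rightarrow> bool" where
  "has_multiplicity D\<^sub>1 D\<^sub>2 \<phi> m \<longleftrightarrow>
     (\<forall>w \<in> D\<^sub>2 - critical_values \<phi> D\<^sub>1. finite {z \<in> D\<^sub>1. \<phi> z = w} \<and> card {z \<in> D\<^sub>1. \<phi> z = w} = m)"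

definition square_integrable_on :: "(complex^'n \<Rightarrow> complex) \<Rightarrow> (complex^'n) set \<Rightarrow> bool" where
  "square_integrable_on f D \<longleftrightarrow>
     f \<in> borel_measurable (lebesgue_on D) \<and> integrable (lebesgue_on D) (\<lambda>z. (cmod (f z))\<^sup>2)"

definition L2_inner ::
    "(complex^'n) set \<Rightarrow> (complex^'n \<Rightarrow> complex) \<Rightarrow> (complex^'n \<Rightarrow> complex) \<Rightarrow> complex" where
  "L2_inner D f g = (\<integral>z. f z * cnj (g z) \<partial>lebesgue_on D)"

text \<open>A class in \<open>A\<^sup>2(D)\<close> has exactly one holomorphic representative on \<open>D\<close>. It is made a unique
  function on the whole type by the value \<open>0\<close> outside \<open>D\<close>.\<close>

definition bergman_space :: "(complex^'n) set \<Rightarrow> (complex^'n \<Rightarrow> complex) set" where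
  "bergman_space D =
     {f. holomorphic_fun_on f D \<and> square_integrable_on f D \<and> (\<forall>z. z \<notin> D \<longrightarrow> f z = 0)}"

text \<open>Meaningful for \<open>f\<close> square integrable on \<open>D\<close>, where \<open>f\<close> represents its class in \<open>L\<^sup>2(D)\<close>.\<close>

definition bergman_projection ::
    "(complex^'n) set \<Rightarrow> (complex^'n \<Rightarrow> complex) \<Rightarrow> complex^'n \<Rightarrow> complex" where
  "bergman_projection D f =
     (THE h. h \<in> bergman_space D \<and> (\<forall>g\<in>bergman_space D. L2_inner D (\<lambda>z. f z - h z) g = 0))"

definition friedrichs_operator ::
    "(complex^'n) set \<Rightarrow> (complex^'n \<Rightarrow> complex) \<Rightarrow> complex^'n \<Rightarrow> complex" where
  "friedrichs_operator D g = bergman_projection D (\<lambda>z. cnj (g z))"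

definition fun_scale :: "complex \<Rightarrow> (complex^'n \<Rightarrow> complex) \<Rightarrow> complex^'n \<Rightarrow> complex" where
  "fun_scale c f = (\<lambda>z. c * f z)"

lemma vector_space_fun_scale: "vector_space fun_scale"
  by unfold_locales (auto simp: fun_scale_def algebra_simps)

definition rank_one_on ::
    "((complex^'n \<Rightarrow> complex) \<Rightarrow> complex^'n \<Rightarrow> complex) \<Rightarrow> (complex^'n \<Rightarrow> complex) set \<Rightarrow> bool" where
  "rank_one_on F A \<longleftrightarrow> module.subspace fun_scale (F ` A) \<and> vector_space.dim fun_scale (F ` A) = 1"

end

theory Submission
  imports Defs "HOL-Complex_Analysis.Conformal_Mappings"
begin

text \<open>Write \<open>w\<^sub>0 = \<phi> 0\<close>, let \<open>V\<close> be the volume of \<open>D\<^sub>2\<close> and let \<open>J\<close> be the complex Jacobian of \<open>\<phi>\<close>. The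
  theorem follows from the quadrature identity
  \<open>\<integral> f g = V * f w\<^sub>0 * g w\<^sub>0\<close> over \<open>D\<^sub>2\<close>, for all \<open>f\<close> and \<open>g\<close> in the Bergman space of \<open>D\<^sub>2\<close>.
  It says that \<open>cnj g\<close> and the constant \<open>cnj (g w\<^sub>0)\<close> have the same inner products with the Bergman
  space, so the Friedrichs operator maps \<open>g\<close> to the constant \<open>cnj (g w\<^sub>0)\<close>, and its range consists of
  the constants (\<open>friedrichs_operator_of_quadrature\<close>, \<open>rank_one_of_quadrature\<close>).

  To prove the identity, pull it back along the \<open>m\<close>-sheeted map \<open>\<phi>\<close>: by
  \<open>change_of_variables_multiplicity\<close>, \<open>m\<close> times the integral of \<open>f g\<close> over \<open>D\<^sub>2\<close> is the integral of
  \<open>G * \<bar>J\<bar>\<^sup>2\<close> over \<open>D\<^sub>1\<close>, where \<open>G = (f g) \<circ> \<phi>\<close> is holomorphic. Since \<open>J\<close> is homogeneous, \<open>\<bar>J\<bar>\<^sup>2\<close> is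
  invariant under the rotations \<open>z \<mapsto> e\<^sup>i\<^sup>\<theta> z\<close> of \<open>D\<^sub>1\<close>, so \<open>G\<close> may be replaced by its average over these
  rotations. This average equals \<open>G 0\<close> near the origin by the Cauchy integral formula and hence on all
  of the connected set \<open>D\<^sub>1\<close> by the identity theorem. The integral is therefore \<open>G 0\<close> times a constant
  \<open>I\<close> (\<open>integral_circular_weight\<close>). The choice \<open>f = g = 1\<close> gives \<open>m V = I\<close>, and the identity follows
  once \<open>I \<noteq> 0\<close>.

  That \<open>I \<noteq> 0\<close> means that \<open>J\<close> is not identically zero on \<open>D\<^sub>1\<close>, which holds for every proper holomorphic
  map between domains of the same dimension (\<open>proper_holomorphic_map_jacobian_nonzero\<close>): otherwise
  fibres would contain holomorphic discs through their points of maximal rank, and compactness of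
  the fibres would contradict the maximum modulus principle.

  The change of variables rests on the equality of \<open>\<bar>J\<bar>\<^sup>2\<close> with the modulus of the real Jacobian
  determinant (\<open>abs_det_real_matrix\<close>).\<close>

section \<open>Holomorphic functions of several variables\<close>

lemma norm_smult_complex: "norm (t *s (v::complex^'n)) = cmod t * norm v"
  by (simp add: norm_vec_def norm_mult L2_set_right_distrib)

lemma bounded_linear_smult_left: "bounded_linear (\<lambda>t. t *s (v::complex^'n))"
  by (rule bounded_linear_intro[of _ "norm v"])
     (auto simp: norm_smult_complex vec_eq_iff algebra_simps)

lemma bounded_linear_smult_right: "bounded_linear (\<lambda>v. c *s (v::complex^'n))"
  by (rule bounded_linear_intro[of _ "cmod c"])
     (auto simp: norm_smult_complex vec_eq_iff algebra_simps)

lemma line_has_derivative: "((\<lambda>t. z + t *s (v::complex^'n)) has_derivative (\<lambda>h. h *s v)) (at t)"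
proof -
  have "((\<lambda>t. t *s v) has_derivative (\<lambda>h. h *s v)) (at t)"
    using bounded_linear_imp_has_derivative[OF bounded_linear_smult_left] .
  then have "((\<lambda>t. z + t *s v) has_derivative (\<lambda>h. 0 + h *s v)) (at t)"
    by (intro derivative_intros)
  then show ?thesis by simp
qed

lemma holomorphic_fun_on_frechet:
  assumes "holomorphic_fun_on f D" "z \<in> D"
  shows "(f has_derivative frechet_derivative f (at z)) (at z)"
    and "frechet_derivative f (at z) (c *s v) = c * frechet_derivative f (at z) v"
  using assms frechet_derivative_at unfolding holomorphic_fun_on_def by metis+

lemma holomorphic_fun_on_imp_continuous_on:
  assumes "holomorphic_fun_on f D" shows "continuous_on D f"
  using holomorphic_fun_on_frechet[OF assms]
  by (meson continuous_at_imp_continuous_on has_derivative_continuous)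

lemma has_field_derivative_along_curve:
  assumes "holomorphic_fun_on f D" "c t \<in> D" "(c has_derivative (\<lambda>h. h *s v)) (at t)"
  shows "((\<lambda>t. f (c t)) has_field_derivative frechet_derivative f (at (c t)) v) (at t)"
  using has_derivative_compose[OF assms(3) holomorphic_fun_on_frechet(1)[OF assms(1,2)]]
  by (simp add: has_field_derivative_def holomorphic_fun_on_frechet(2)[OF assms(1,2)] mult.commute[of _ "frechet_derivative f (at (c t)) v"])

text \<open>Differentiability at each point already forces a continuous derivative. Restricted to the disc
  \<open>t \<mapsto> z + t v\<close>, the derivative of \<open>f\<close> in direction \<open>v\<close> is a one-variable derivative at \<open>0\<close>, and the Cauchy
  inequality bounds the difference of two such derivatives by the difference of \<open>f\<close> on the two discs,
  which is small by uniform continuity.\<close>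

lemma continuous_on_frechet_derivative:
  assumes hf: "holomorphic_fun_on f D" and D: "open D"
  shows "continuous_on D (\<lambda>z. frechet_derivative f (at z) v)"
proof (rule continuous_at_imp_continuous_on, rule ballI)
  fix z0 assume "z0 \<in> D"
  then obtain R0 where "R0 > 0" "cball z0 R0 \<subseteq> D"
    using D open_contains_cball by blast
  define R where "R = R0 / 2"
  have R: "R > 0" "cball z0 (2*R) \<subseteq> D" using \<open>R0 > 0\<close> \<open>cball z0 R0 \<subseteq> D\<close> by (auto simp: R_def)
  \<comment> \<open>The \<open>1\<close> in the denominator covers \<open>v = 0\<close>. Discs of radius \<open>r\<close> in direction \<open>v\<close>
    around points of \<open>ball z0 R\<close> stay in the compact ball of radius \<open>2 * R\<close>.\<close>
  define r where "r = R / (norm v + 1)"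
  have r: "r > 0" "r * norm v \<le> R" using R
    by (auto simp: r_def divide_simps algebra_simps add_pos_nonneg add_nonneg_pos intro!: mult_left_mono)

  have in_ball: "z + t *s v \<in> cball z0 (2*R)" if "dist z z0 \<le> R" "cmod t \<le> r" for z t
  proof -
    have "dist (z + t *s v) z0 \<le> dist z z0 + cmod t * norm v"
      by (smt (verit, best) dist_norm dist_triangle dist_commute norm_smult_complex add_diff_cancel_left')
    also have "\<dots> \<le> R + r * norm v" using that by (intro add_mono mult_right_mono) auto
    finally show ?thesis using r by (simp add: dist_commute)
  qed
  have "uniformly_continuous_on (cball z0 (2*R)) f"
    using holomorphic_fun_on_imp_continuous_on[OF hf] R continuous_on_subset
    by (intro compact_uniformly_continuous) auto
  then have uc: "\<exists>d>0. \<forall>x\<in>cball z0 (2*R). \<forall>y\<in>cball z0 (2*R). dist y x < d \<longrightarrow> dist (f y) (f x) < e"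
    if "e > 0" for e
    using that unfolding uniformly_continuous_on_def by blast
  show "isCont (\<lambda>z. frechet_derivative f (at z) v) z0"
    unfolding continuous_at_eps_delta
  proof (intro allI impI)
    fix e :: real assume "e > 0"
    then obtain d where d: "d > 0" "\<And>x y. x \<in> cball z0 (2*R) \<Longrightarrow> y \<in> cball z0 (2*R) \<Longrightarrow> dist y x < d \<Longrightarrow>
        dist (f y) (f x) < e * r / 2"
      using uc[of "e * r / 2"] r by auto
    show "\<exists>d>0. \<forall>z. dist z z0 < d \<longrightarrow>
          dist (frechet_derivative f (at z) v) (frechet_derivative f (at z0) v) < e"
    proof (intro exI[of _ "min d R"] conjI allI impI)
      fix z assume "dist z z0 < min d R"
      then have z: "dist z z0 < d" "dist z z0 \<le> R" by auto
      let ?u = "\<lambda>t. f (z + t *s v) - f (z0 + t *s v)"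
      have der: "(?u has_field_derivative frechet_derivative f (at (z + t *s v)) v
           - frechet_derivative f (at (z0 + t *s v)) v) (at t)" if "cmod t \<le> r" for t
        using in_ball[OF z(2) that] in_ball[of z0, OF _ that] R
        by (intro DERIV_diff has_field_derivative_along_curve[OF hf _ line_has_derivative]) auto
      have "norm ((deriv ^^ 1) ?u 0) \<le> fact 1 * (e * r / 2) / r ^ 1"
      proof (rule Cauchy_inequality)
        show "?u holomorphic_on ball 0 r"
          unfolding holomorphic_on_open[OF open_ball]
        proof
          fix t :: complex assume "t \<in> ball 0 r"
          then have "cmod t \<le> r" by simp
          from der[OF this] show "\<exists>f'. (?u has_field_derivative f') (at t)" by blast
        qed
        show "continuous_on (cball 0 r) ?u"
        proof (intro continuous_at_imp_continuous_on ballI)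
          fix t :: complex assume "t \<in> cball 0 r"
          then have "cmod t \<le> r" by simp
          from der[OF this] show "isCont ?u t" by (rule DERIV_isCont)
        qed
        show "cmod (?u x) \<le> e * r / 2" if "cmod (0 - x) = r" for x
          using d(2)[OF in_ball[of z0 x] in_ball[of z x]] z that R(1)
          by (simp add: dist_norm less_imp_le)
      qed (use r in auto)
      moreover have "deriv ?u 0 = frechet_derivative f (at z) v - frechet_derivative f (at z0) v"
        using DERIV_imp_deriv[OF der[of 0]] r by simp
      ultimately show "dist (frechet_derivative f (at z) v) (frechet_derivative f (at z0) v) < e"
        using r \<open>e > 0\<close> by (simp add: dist_norm)
    qed (use d R in auto)
  qed
qed

text \<open>This replaces the holomorphy of the partial derivatives as functions of all variables. Along a
  holomorphic disc they are locally uniform limits of difference quotients of \<open>f\<close>.\<close>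

lemma holomorphic_on_frechet_derivative_along_curve:
  fixes c :: "complex \<Rightarrow> complex^'n"
  assumes hf: "holomorphic_fun_on f D" and D: "open D" and V: "open V"
    and c: "\<And>t. t \<in> V \<Longrightarrow> c t \<in> D"
    and dc: "\<And>t. t \<in> V \<Longrightarrow> (c has_derivative (\<lambda>h. h *s c' t)) (at t)"
  shows "(\<lambda>t. frechet_derivative f (at (c t)) v) holomorphic_on V"
proof -
  have "\<exists>U. open U \<and> t0 \<in> U \<and> U \<subseteq> V \<and> (\<lambda>t. frechet_derivative f (at (c t)) v) holomorphic_on U"
    if "t0 \<in> V" for t0
  proof -
    obtain r where r: "r > 0" "cball t0 r \<subseteq> V" using V \<open>t0 \<in> V\<close> open_contains_cball by blast
    define K where "K = c ` cball t0 r"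
    have "continuous_on (cball t0 r) c"
      using dc r by (meson continuous_at_imp_continuous_on has_derivative_continuous subsetD)
    then have "compact K" unfolding K_def by (intro compact_continuous_image) auto
    moreover have "K \<subseteq> D" using c r by (auto simp: K_def)
    ultimately obtain e where e: "e > 0" "(\<Union>x\<in>K. ball x e) \<subseteq> D"
      using compact_subset_open_imp_ball_epsilon_subset[OF _ D] by metis
    define K' where "K' = {x + y | x y. x \<in> K \<and> y \<in> cball 0 (e/2)}"
    have "compact K'" unfolding K'_def by (intro compact_sums \<open>compact K\<close>) auto
    have K'D: "K' \<subseteq> D" 
    proof
      fix w assume "w \<in> K'"
      then obtain x y where "w = x + y" "x \<in> K" "y \<in> cball 0 (e/2)" by (auto simp: K'_def)
      then have "w \<in> ball x e" "x \<in> K" using e(1) by (auto simp: dist_norm)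
      then show "w \<in> D" using e(2) by blast
    qed
    define d where "d = e / (2 * (norm v + 1))"
    have nv: "norm v + 1 > 0" by (simp add: add_nonneg_pos)
    have d: "d > 0" "d * norm v \<le> e / 2"
      using e nv by (auto simp: d_def field_simps)
    have inK': "c t + s *s v \<in> K'" if "t \<in> cball t0 r" "cmod s \<le> d" for t s
    proof -
      have "norm (s *s v) \<le> d * norm v" 
        using that by (auto simp: norm_smult_complex intro: mult_right_mono)
      then have "s *s v \<in> cball 0 (e/2)" using d(2) by simp
      moreover have "c t \<in> K" using that by (auto simp: K_def)
      ultimately show ?thesis unfolding K'_def by blast
    qed
    define q where "q = (\<lambda>n. complex_of_real (d / real (Suc n)))"
    have qn: "cmod (q n) = d * inverse (real (Suc n))" for n
      unfolding q_def norm_of_real using d(1) by (simp add: divide_inverse)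
    have q: "cmod (q n) \<le> d" "q n \<noteq> 0" for n
    proof -
      show "cmod (q n) \<le> d" unfolding qn using d(1) by (intro mult_left_le) (auto simp: inverse_le_1_iff)
      show "q n \<noteq> 0" using d(1) qn[of n] by (metis inverse_nonzero_iff_nonzero mult_eq_0_iff norm_zero of_nat_0_eq_iff less_irrefl nat.distinct(1))
    qed
    have q0: "(\<lambda>n. cmod (q n)) \<longlonglongrightarrow> 0"
    proof -
      have "(\<lambda>n. d * inverse (real (Suc n))) \<longlonglongrightarrow> d * 0"
        by (intro tendsto_mult_left LIMSEQ_inverse_real_of_nat)
      then show ?thesis unfolding qn by simp
    qed
    let ?g = "\<lambda>t. frechet_derivative f (at (c t)) v"
    \<comment> \<open>Difference quotients with steps \<open>q n\<close> tending to \<open>0\<close>: holomorphic in \<open>t\<close>, and uniformly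
      convergent because the derivative is uniformly continuous on \<open>K'\<close>.\<close>
    let ?F = "\<lambda>n t. (f (c t + q n *s v) - f (c t)) / q n"
    have "uniformly_continuous_on K' (\<lambda>z. frechet_derivative f (at z) v)"
      using continuous_on_frechet_derivative[OF hf D] K'D continuous_on_subset \<open>compact K'\<close>
      by (intro compact_uniformly_continuous) blast+
    then have uc: "\<exists>d>0. \<forall>x\<in>K'. \<forall>y\<in>K'. dist y x < d \<longrightarrow>
        dist (frechet_derivative f (at y) v) (frechet_derivative f (at x) v) < e"
      if "e > 0" for e
      using that unfolding uniformly_continuous_on_def by blast
    have lim: "uniform_limit (cball t0 r) ?F ?g sequentially"
    proof (rule uniform_limitI)
      fix \<epsilon> :: real assume "\<epsilon> > 0"
      then obtain \<delta> where \<delta>: "\<delta> > 0" "\<And>x y. x \<in> K' \<Longrightarrow> y \<in> K' \<Longrightarrow> dist y x < \<delta> \<Longrightarrow>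
          dist (frechet_derivative f (at y) v) (frechet_derivative f (at x) v) < \<epsilon> / 2"
        using uc[of "\<epsilon>/2"] by auto
      have "\<delta> / (norm v + 1) > 0" using nv \<delta> by simp
      with q0 have "\<forall>\<^sub>F n in sequentially. cmod (q n) < \<delta> / (norm v + 1)"
        by (rule order_tendstoD(2))
      then show "\<forall>\<^sub>F n in sequentially. \<forall>t\<in>cball t0 r. dist (?F n t) (?g t) < \<epsilon>"
      proof eventually_elim
        case (elim n)
        show ?case
        proof
          fix t assume t: "t \<in> cball t0 r"
          let ?u = "\<lambda>s. f (c t + s *s v) - s * ?g t"
          have "cmod (?u (q n) - ?u 0) \<le> (\<epsilon>/2) * cmod (q n - 0)"
          proof (rule field_differentiable_bound[where S = "cball 0 (cmod (q n))"])
            fix s :: complex assume s: "s \<in> cball 0 (cmod (q n))"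
            have sd: "cmod s \<le> d" using s q[of n] by simp
            have "((\<lambda>s. f (c t + s *s v)) has_field_derivative
                frechet_derivative f (at (c t + s *s v)) v) (at s)"
              using inK'[OF t sd] K'D 
              by (intro has_field_derivative_along_curve[OF hf _ line_has_derivative]) auto
            then have "(?u has_field_derivative 
                (frechet_derivative f (at (c t + s *s v)) v - 1 * ?g t)) (at s)"
              by (intro DERIV_diff DERIV_cmult_right DERIV_ident)
            then show "(?u has_field_derivative 
                (frechet_derivative f (at (c t + s *s v)) v - ?g t)) (at s within cball 0 (cmod (q n)))"
              by (simp add: has_field_derivative_at_within)
            have "dist (c t + s *s v) (c t) = cmod s * norm v" by (simp add: dist_norm norm_smult_complex)
            also have "\<dots> \<le> cmod (q n) * (norm v + 1)" using s by (intro mult_mono) auto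
            also have "\<dots> < \<delta>" using elim nv by (simp add: field_simps)
            finally show "cmod (frechet_derivative f (at (c t + s *s v)) v - ?g t) \<le> \<epsilon>/2"
              using \<delta>(2)[OF inK'[OF t, of 0] inK'[OF t sd]] d(1) by (simp add: dist_norm)
          qed auto
          moreover have "?u (q n) - ?u 0 = q n * (?F n t - ?g t)"
            using q(2)[of n] by (simp add: field_simps)
          ultimately have "cmod (q n) * cmod (?F n t - ?g t) \<le> (\<epsilon>/2) * cmod (q n)"
            by (simp add: norm_mult)
          then have "cmod (?F n t - ?g t) \<le> \<epsilon>/2" using q(2)[of n] by simp
          then show "dist (?F n t) (?g t) < \<epsilon>" using \<open>\<epsilon> > 0\<close> by (simp add: dist_norm)
        qed
      qed
    qed
    have holF: "?F n holomorphic_on cball t0 r" for n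
    proof -
      have "\<exists>f'. (?F n has_field_derivative f') (at t)" if t: "t \<in> cball t0 r" for t
      proof -
        have tV: "t \<in> V" using t r by blast
        have "((\<lambda>t. c t + q n *s v) has_derivative (\<lambda>h. h *s c' t)) (at t)"
          using has_derivative_add[OF dc[OF tV] has_derivative_const[of "q n *s v"]] by simp
        then have "((\<lambda>t. f (c t + q n *s v)) has_field_derivative
              frechet_derivative f (at (c t + q n *s v)) (c' t)) (at t)"
          using inK'[OF t q(1)[of n]] K'D by (intro has_field_derivative_along_curve[OF hf]) auto
        moreover have "((\<lambda>t. f (c t)) has_field_derivative frechet_derivative f (at (c t)) (c' t)) (at t)"
          by (intro has_field_derivative_along_curve[OF hf] c dc tV)
        ultimately show ?thesis
          using DERIV_cdivide[OF DERIV_diff] by blast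
      qed
      then show ?thesis
        unfolding holomorphic_on_def field_differentiable_def using has_field_derivative_at_within by blast
    qed
    have "?g holomorphic_on ball t0 r"
    proof (rule holomorphic_uniform_limit[OF _ lim])
      show "\<forall>\<^sub>F n in sequentially. continuous_on (cball t0 r) (?F n) \<and> ?F n holomorphic_on ball t0 r"
        using holF holomorphic_on_imp_continuous_on holomorphic_on_subset[OF _ ball_subset_cball]
        by (intro always_eventually) blast
    qed auto
    moreover have "ball t0 r \<subseteq> V" using r(2) ball_subset_cball by blast
    ultimately show ?thesis using r(1) by (intro exI[of _ "ball t0 r"]) simp
  qed
  then obtain U where U: "\<And>t. t \<in> V \<Longrightarrow> open (U t) \<and> t \<in> U t \<and> U t \<subseteq> V \<and>
      (\<lambda>t. frechet_derivative f (at (c t)) v) holomorphic_on U t"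
    by metis
  have "(\<lambda>t. frechet_derivative f (at (c t)) v) holomorphic_on (\<Union>t\<in>V. U t)"
    using U by (intro holomorphic_on_UN_open) auto
  moreover have "(\<Union>t\<in>V. U t) = V" using U by blast
  ultimately show ?thesis by simp
qed

lemma holomorphic_fun_on_diff_cmult:
  assumes "holomorphic_fun_on f D" "holomorphic_fun_on g D"
  shows "holomorphic_fun_on (\<lambda>z. c * f z - g z) D"
  unfolding holomorphic_fun_on_def
proof (intro ballI exI conjI allI)
  fix z assume z: "z \<in> D"
  show "((\<lambda>z. c * f z - g z) has_derivative
      (\<lambda>v. c * frechet_derivative f (at z) v - frechet_derivative g (at z) v)) (at z)"
    by (intro has_derivative_diff has_derivative_mult_right holomorphic_fun_on_frechet(1)[OF assms(1) z]
        holomorphic_fun_on_frechet(1)[OF assms(2) z])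
qed (simp add: holomorphic_fun_on_frechet(2)[OF assms(1)] holomorphic_fun_on_frechet(2)[OF assms(2)] algebra_simps)

lemma holomorphic_fun_on_mult:
  assumes "holomorphic_fun_on f D" "holomorphic_fun_on g D"
  shows "holomorphic_fun_on (\<lambda>z. f z * g z) D"
  unfolding holomorphic_fun_on_def
proof (intro ballI exI conjI allI)
  fix z assume z: "z \<in> D"
  show "((\<lambda>z. f z * g z) has_derivative
      (\<lambda>v. f z * frechet_derivative g (at z) v + frechet_derivative f (at z) v * g z)) (at z)"
    by (intro has_derivative_mult holomorphic_fun_on_frechet(1)[OF assms(1) z]
        holomorphic_fun_on_frechet(1)[OF assms(2) z])
qed (simp add: holomorphic_fun_on_frechet(2)[OF assms(1)] holomorphic_fun_on_frechet(2)[OF assms(2)] algebra_simps)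

section \<open>Averages over rotations of a circular domain\<close>

lemma circular_cis:
  assumes "circular D" "z \<in> D" shows "cis \<theta> *s z \<in> D"
  using assms unfolding circular_def cis_conv_exp by blast

definition circle_integral :: "(complex^'n \<Rightarrow> complex) \<Rightarrow> complex^'n \<Rightarrow> complex" where
  "circle_integral G z = integral {0..2*pi} (\<lambda>\<theta>. G (cis \<theta> *s z))"

lemma continuous_on_rotation:
  assumes "continuous_on D G" "circular D" "continuous_on A c" "continuous_on A r" "c ` A \<subseteq> D"
  shows "continuous_on A (\<lambda>x. G (cis (r x) *s (c x :: complex^'n)))"
proof (rule continuous_on_compose2[OF assms(1)])
  show "continuous_on A (\<lambda>x. cis (r x) *s c x)"
    unfolding vector_scalar_mult_def
    by (intro continuous_intros assms)
  show "(\<lambda>x. cis (r x) *s c x) ` A \<subseteq> D"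
    using assms circular_cis by blast
qed

lemma circle_integral_holomorphic_on_line:
  assumes hG: "holomorphic_fun_on G D" and D: "open D" "circular D"
    and S: "convex S" "open S" "\<And>t. t \<in> S \<Longrightarrow> a + t *s b \<in> D"
  shows "(\<lambda>t. circle_integral G (a + t *s b)) holomorphic_on S"
proof -
  have "(\<lambda>t. integral (cbox 0 (2*pi)) (\<lambda>\<theta>. G (cis \<theta> *s (a + t *s b)))) holomorphic_on S"
  proof (rule leibniz_rule_holomorphic[where 
      fx = "\<lambda>t \<theta>. cis \<theta> * frechet_derivative G (at (cis \<theta> *s (a + t *s b))) b"])
    fix t :: complex and \<theta> :: real assume t: "t \<in> S"
    have "((\<lambda>t. cis \<theta> *s (a + t *s b)) has_derivative (\<lambda>h. cis \<theta> *s (h *s b))) (at t)"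
      by (rule has_derivative_compose[OF line_has_derivative 
            bounded_linear_imp_has_derivative[OF bounded_linear_smult_right]])
    then have "((\<lambda>t. cis \<theta> *s (a + t *s b)) has_derivative (\<lambda>h. h *s (cis \<theta> *s b))) (at t)"
      by (simp add: mult.commute)
    from has_field_derivative_along_curve[OF hG _ this]
    have "((\<lambda>t. G (cis \<theta> *s (a + t *s b))) has_field_derivative
        frechet_derivative G (at (cis \<theta> *s (a + t *s b))) (cis \<theta> *s b)) (at t)"
      using S(3)[OF t] circular_cis[OF D(2)] by blast
    also have "frechet_derivative G (at (cis \<theta> *s (a + t *s b))) (cis \<theta> *s b) =
        cis \<theta> * frechet_derivative G (at (cis \<theta> *s (a + t *s b))) b"
      using S(3)[OF t] circular_cis[OF D(2)] holomorphic_fun_on_frechet(2)[OF hG] by blast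
    finally show "((\<lambda>t. G (cis \<theta> *s (a + t *s b))) has_field_derivative
       cis \<theta> * frechet_derivative G (at (cis \<theta> *s (a + t *s b))) b) (at t within S)"
      by (rule has_field_derivative_at_within)
  next
    fix t assume "t \<in> S"
    show "(\<lambda>\<theta>. G (cis \<theta> *s (a + t *s b))) integrable_on cbox 0 (2*pi)"
      using S(3)[OF \<open>t \<in> S\<close>]
      by (intro integrable_continuous continuous_on_rotation[OF holomorphic_fun_on_imp_continuous_on[OF hG] D(2)]
          continuous_intros) auto
  next
    have lin: "continuous_on A (\<lambda>x. a + f x *s b)" if "continuous_on A f" for A :: "(complex\<times>real) set" and f
      unfolding vector_scalar_mult_def by (intro continuous_intros that)
    show "continuous_on (S \<times> cbox 0 (2*pi)) (\<lambda>(t, \<theta>). cis \<theta> * frechet_derivative G (at (cis \<theta> *s (a + t *s b))) b)"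
      unfolding case_prod_unfold
      using S(3)
      by (intro continuous_intros lin
          continuous_on_rotation[OF continuous_on_frechet_derivative[OF hG D(1)] D(2)]) auto
  qed (use S in auto)
  then show ?thesis by (simp add: circle_integral_def)
qed

text \<open>The identity theorem in several variables, for a function known to be holomorphic only along complex
  lines: the set of points near which the function is constant is open and closed in the domain.\<close>

lemma constant_of_holomorphic_on_lines:
  fixes A :: "complex^'n \<Rightarrow> complex"
  assumes D: "open D" "connected D" "a0 \<in> D"
    and hol: "\<And>S a b. convex S \<Longrightarrow> open S \<Longrightarrow> (\<And>t. t \<in> S \<Longrightarrow> a + t *s b \<in> D) \<Longrightarrow>
                (\<lambda>t. A (a + t *s b)) holomorphic_on S"
    and near: "r0 > 0" "\<And>z. z \<in> ball a0 r0 \<Longrightarrow> A z = k"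
    and z: "z \<in> D"
  shows "A z = k"
proof -
  \<comment> \<open>Inside a ball of the domain, constancy near one point \<open>s\<close> spreads to every point \<open>w\<close>:
    apply the identity theorem on the part of the line through \<open>s\<close> and \<open>w\<close> in the ball.\<close>
  have ball: "A w = k" if B: "ball x r \<subseteq> D" "w \<in> ball x r" and s: "s \<in> ball x r" "e > 0" "\<And>y. y \<in> ball s e \<Longrightarrow> A y = k"
    for x r w s e
  proof -
    let ?l = "\<lambda>t. s + t *s (w - s)"
    define S where "S = ?l -` ball x r"
    have cont: "continuous_on UNIV ?l"
      by (intro continuous_at_imp_continuous_on ballI has_derivative_continuous[OF line_has_derivative])
    have "open S" unfolding S_def by (rule open_vimage[OF open_ball cont])
    have "convex S" unfolding S_def
    proof (rule convexI)
      fix t1 t2 and u v :: real assume h: "t1 \<in> ?l -` ball x r" "t2 \<in> ?l -` ball x r" "0 \<le> u" "0 \<le> v" "u + v = 1"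
      have "u *\<^sub>R ?l t1 + v *\<^sub>R ?l t2 = (u + v) *\<^sub>R s + (u *\<^sub>R t1 + v *\<^sub>R t2) *s (w - s)"
        by (simp add: vec_eq_iff algebra_simps scaleR_conv_of_real[where 'a=complex])
      then have "?l (u *\<^sub>R t1 + v *\<^sub>R t2) = u *\<^sub>R ?l t1 + v *\<^sub>R ?l t2" using h by simp
      also have "\<dots> \<in> ball x r" using h(1,2) by (intro convexD[OF convex_ball _ _ h(3,4,5)]) (simp_all only: vimage_eq)
      finally show "u *\<^sub>R t1 + v *\<^sub>R t2 \<in> ?l -` ball x r" by simp
    qed
    have holS: "(\<lambda>t. A (?l t) - k) holomorphic_on S"
      using B by (intro holomorphic_intros hol \<open>convex S\<close> \<open>open S\<close>) (auto simp: S_def)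
    have 0: "0 \<in> S" and 1: "1 \<in> S" using s B by (auto simp: S_def)
    define U where "U = S \<inter> ?l -` ball s e"
    have "open U" unfolding U_def by (intro open_Int \<open>open S\<close> open_vimage[OF open_ball cont])
    moreover have "0 \<in> U" using 0 s by (auto simp: U_def)
    moreover have "A (?l t) - k = 0" if "t \<in> U" for t using that s(3) by (simp add: U_def)
    moreover have "connected S" by (rule convex_connected[OF \<open>convex S\<close>])
    moreover have "U \<subseteq> S" by (simp add: U_def)
    ultimately have "A (?l 1) - k = 0"
      using analytic_continuation_open[of U S "\<lambda>t. A (?l t) - k" "\<lambda>_. 0" 1] \<open>open S\<close> holS 1
        holomorphic_on_const by blast
    then show "A w = k" by simp
  qed
  define E where "E = {z \<in> D. \<exists>e>0. \<forall>y\<in>ball z e. A y = k}"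
  have opE: "open E"
    unfolding open_subopen[of E]
  proof
    fix z assume "z \<in> E"
    then obtain e where e: "e > 0" "\<forall>y\<in>ball z e. A y = k" and "z \<in> D" by (auto simp: E_def)
    have "ball z e \<inter> D \<subseteq> E"
    proof
      fix y assume y: "y \<in> ball z e \<inter> D"
      then obtain e' where "e' > 0" "ball y e' \<subseteq> ball z e" using openE[OF open_ball, of y z e] by blast
      then show "y \<in> E" using e y by (auto simp: E_def)
    qed
    then show "\<exists>T. open T \<and> z \<in> T \<and> T \<subseteq> E" using e \<open>z \<in> D\<close> D(1)
      by (intro exI[of _ "ball z e \<inter> D"]) auto
  qed
  have "E = {} \<or> E = D"
  proof -
    have "openin (top_of_set D) E" using opE by (simp add: E_def open_openin_trans D(1))
    moreover have "closedin (top_of_set D) E"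
      unfolding closedin_limpt
    proof (intro conjI allI impI)
      show "E \<subseteq> D" by (auto simp: E_def)
      fix x assume x: "x islimpt E \<and> x \<in> D"
      then obtain r where r: "r > 0" "ball x r \<subseteq> D" using D(1) openE by blast
      obtain s where s: "s \<in> E" "s \<in> ball x r"
        using x r(1) unfolding islimpt_approachable by (auto simp: dist_commute)
      then obtain e where "e > 0" "\<forall>y\<in>ball s e. A y = k" by (auto simp: E_def)
      then have "\<forall>w\<in>ball x r. A w = k" using ball[OF r(2) _ s(2)] by blast
      then show "x \<in> E" using r x by (auto simp: E_def)
    qed
    ultimately show ?thesis using D(2) unfolding connected_clopen by blast
  qed
  moreover have "a0 \<in> E" using near D(3) by (auto simp: E_def)
  ultimately have "z \<in> E" using z by auto
  then obtain e where "e > 0" "\<forall>y\<in>ball z e. A y = k" by (auto simp: E_def)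
  then show ?thesis by auto
qed

text \<open>The disc spanned by \<open>z\<close> need not lie in \<open>D\<close>, so the mean value property applies only near the origin;
  connectedness of \<open>D\<close> carries it to the other points.\<close>

lemma circle_integral_eq:
  fixes G :: "complex^'n \<Rightarrow> complex"
  assumes hG: "holomorphic_fun_on G D" and D: "open D" "connected D" "circular D" "0 \<in> D" and z: "z \<in> D"
  shows "circle_integral G z = 2 * pi * G 0"
proof -
  obtain r where r: "r > 0" "ball 0 r \<subseteq> D" using D openE by blast
  show ?thesis
  proof (rule constant_of_holomorphic_on_lines[OF D(1,2,4) _ r(1) _ z])
    show "(\<lambda>t. circle_integral G (a + t *s b)) holomorphic_on S"
      if "convex S" "open S" "\<And>t. t \<in> S \<Longrightarrow> a + t *s b \<in> D" for S a b
      using circle_integral_holomorphic_on_line[OF hG D(1,3) that] .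
    \<comment> \<open>Near the origin the closed disc spanned by \<open>z\<close> lies in the domain, and the claim is
      the Cauchy integral formula on it.\<close>
    fix z :: "complex^'n" assume z: "z \<in> ball 0 r"
    have "t *s z \<in> D" if "t \<in> cball 0 1" for t :: complex
    proof -
      have "norm (t *s z) \<le> 1 * norm z" using that by (simp add: norm_smult_complex mult_left_le_one_le)
      then show ?thesis using z r by auto
    qed
    then have "((\<lambda>t. G (0 + t *s z)) has_field_derivative frechet_derivative G (at (0 + t *s z)) z) (at t)"
      if "t \<in> cball 0 1" for t :: complex
      using that by (intro has_field_derivative_along_curve[OF hG _ line_has_derivative]) simp
    then have "\<exists>f'. ((\<lambda>t. G (t *s z)) has_field_derivative f') (at t)" if "t \<in> cball 0 1" for t :: complex
      using that by (simp only: add_0) blast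
    then have "(\<lambda>t. G (t *s z)) holomorphic_on cball 0 1"
      unfolding holomorphic_on_def field_differentiable_def using has_field_derivative_at_within by blast
    from Cauchy_integral_circlepath_simple[OF this, of 0]
    have "((\<lambda>u. G (u *s z) / u) has_contour_integral 2 * of_real pi * \<i> * G 0) (part_circlepath 0 1 0 (2*pi))"
      by (simp add: circlepath_def)
    then have "((\<lambda>t. G (cis t *s z) * \<i>) has_integral 2 * of_real pi * \<i> * G 0) {0..2*pi}"
      by (subst (asm) has_contour_integral_part_circlepath_iff) auto
    from has_integral_mult_left[OF this, of "- \<i>"]
    have "((\<lambda>t. G (cis t *s z)) has_integral 2 * of_real pi * G 0) {0..2*pi}"
      by (simp add: algebra_simps)
    then show "circle_integral G z = 2 * pi * G 0"
      unfolding circle_integral_def by (simp add: integral_unique)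
  qed
qed

section \<open>The real determinant of a complex matrix\<close>

text \<open>Sard's theorem and the real change of variables formula are applied in real coordinates, indexed by
  the type \<open>'n bit0\<close>, which is well-ordered and has twice as many elements as \<open>'n\<close>. Any enumeration of the
  basis serves; it makes \<open>realify\<close> a linear isometry that maps boxes to boxes.\<close>

definition coord_basis :: "'n::finite bit0 \<Rightarrow> complex^'n" where
  "coord_basis = (SOME B. bij_betw B UNIV Basis)"

lemma bij_betw_coord_basis: "bij_betw (coord_basis :: 'n::finite bit0 \<Rightarrow> complex^'n) UNIV Basis"
proof -
  have "\<exists>B :: 'n bit0 \<Rightarrow> complex^'n. bij_betw B UNIV Basis"
    by (rule finite_same_card_bij) auto
  then show ?thesis unfolding coord_basis_def by (rule someI_ex)
qed

definition realify :: "complex^'n \<Rightarrow> real^('n::finite bit0)" where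
  "realify z = (\<chi> j. z \<bullet> coord_basis j)"

definition complexify :: "real^('n::finite bit0) \<Rightarrow> complex^'n" where
  "complexify x = (\<Sum>j\<in>UNIV. (x $ j) *\<^sub>R coord_basis j)"

lemma complexify_realify [simp]: "complexify (realify z) = z"
  using sum.reindex_bij_betw[OF bij_betw_coord_basis, of "\<lambda>b. (z \<bullet> b) *\<^sub>R b"]
  by (simp add: complexify_def realify_def euclidean_representation)

lemma coord_basis_in_Basis: "coord_basis j \<in> Basis"
  using bij_betw_coord_basis by (auto simp: bij_betw_def)

lemma inner_coord_basis: "coord_basis i \<bullet> coord_basis j = of_bool (i = j)"
  using bij_betw_coord_basis coord_basis_in_Basis unfolding bij_betw_def inj_def
  by (auto simp: inner_Basis of_bool_def coord_basis_in_Basis)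

lemma realify_complexify [simp]: "realify (complexify x) = x"
  by (simp add: complexify_def realify_def inner_sum_left vec_eq_iff inner_coord_basis)

lemma linear_realify: "linear realify"
  by (rule linearI) (simp_all add: realify_def vec_eq_iff inner_add_left)

lemma linear_complexify: "linear complexify"
  by (rule linearI) (simp_all add: complexify_def scaleR_add_left sum.distrib scaleR_sum_right)

lemma norm_realify: "norm (realify z) = norm z"
proof -
  have "realify z \<bullet> realify z = z \<bullet> z"
    using sum.reindex_bij_betw[OF bij_betw_coord_basis, of "\<lambda>b. (z \<bullet> b) * (z \<bullet> b)"]
    by (simp add: realify_def inner_vec_def[where 'a=real] euclidean_inner[of z z])
  then show ?thesis by (simp add: norm_eq_sqrt_inner)
qed

lemma linear_matrix_vector_mult_real: "linear ((*v) (A :: complex^'n^'m))"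
  by (rule linearI) (simp_all add: matrix_vector_right_distrib vec_eq_iff matrix_vector_mult_def scaleR_sum_right algebra_simps sum.distrib)

definition real_matrix :: "complex^'n^'n \<Rightarrow> real^('n::finite bit0)^('n bit0)" where
  "real_matrix A = matrix (realify \<circ> (*v) A \<circ> complexify)"

lemma linear_realify_matrix: "linear (realify \<circ> (*v) A \<circ> complexify)"
  by (intro linear_compose linear_complexify linear_realify linear_matrix_vector_mult_real)

lemma real_matrix_vector_mult: "real_matrix A *v x = realify (A *v complexify x)"
  unfolding real_matrix_def by (subst matrix_works) (use linear_realify_matrix[of A] in \<open>auto simp: linear_def scalar_mult_eq_scaleR[abs_def]\<close>)

lemma real_matrix_mult: "real_matrix (A ** B) = real_matrix A ** real_matrix B"
  unfolding matrix_eq by (simp add: matrix_vector_mul_assoc[symmetric] real_matrix_vector_mult)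

lemma real_matrix_id: "real_matrix (mat 1) = mat 1"
  unfolding matrix_eq by (simp add: real_matrix_vector_mult)

text \<open>The elementary matrices of Gauss-Jordan elimination: multiplication from the left by a suitable one
  turns a given column into a unit vector.\<close>

definition column_matrix :: "'n \<Rightarrow> complex^'n \<Rightarrow> complex^'n^'n" where
  "column_matrix k a = (\<chi> i j. if j = k then a $ i else of_bool (i = j))"

lemma column_matrix_mult_vec:
  "column_matrix k a *v x = (\<chi> i. (if i = k then 0 else x $ i) + a $ i * x $ k)"
proof -
  have "(column_matrix k a *v x) $ i = (if i = k then 0 else x $ i) + a $ i * x $ k" for i
  proof -
    have "(column_matrix k a *v x) $ i =
      (\<Sum>j\<in>UNIV. (if j = k then a $ i * x $ k else 0) + (if j = i then (if i = k then 0 else x $ i) else 0))"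
      unfolding matrix_vector_mult_def column_matrix_def vec_lambda_beta
      by (intro sum.cong refl) auto
    then show ?thesis by (simp add: sum.distrib)
  qed
  then show ?thesis by (simp add: vec_eq_iff)
qed

lemma column_matrix_mult: "column_matrix k a ** column_matrix k b = column_matrix k (column_matrix k a *v b)"
  unfolding matrix_eq matrix_vector_mul_assoc[symmetric]
  by (auto simp: column_matrix_mult_vec vec_eq_iff algebra_simps)

lemma det_column_matrix: "det (column_matrix k a) = a $ k"
proof -
  have "column_matrix k a = (\<chi> i j. if j = k then (mat 1 *v a) $ i else mat 1 $ i $ j)"
    unfolding matrix_vector_mul_lid by (auto simp: column_matrix_def vec_eq_iff mat_def)
  then show ?thesis using cramer_lemma[of k "mat 1" a] by simp
qed

lemma column_matrix_axis: "column_matrix k (axis k 1) = mat 1"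
  by (auto simp: column_matrix_def vec_eq_iff mat_def axis_def)

definition rdet :: "complex^'n^'n \<Rightarrow> real" where "rdet A = \<bar>det (real_matrix A)\<bar>"

lemma rdet_mult: "rdet (A ** B) = rdet A * rdet B"
  by (simp add: rdet_def real_matrix_mult det_mul abs_mult)

lemma rdet_id: "rdet (mat 1) = 1"
  by (simp add: rdet_def real_matrix_id)

text \<open>A positive real factor in one complex coordinate stretches two real coordinates.\<close>

lemma rdet_scale_axis:
  fixes k :: "'n::finite"
  assumes "r > 0" shows "rdet (column_matrix k (axis k (complex_of_real r))) = r\<^sup>2"
proof -
  let ?A = "column_matrix k (axis k (complex_of_real r)) :: complex^'n^'n"
  define d where "d = (\<lambda>j :: 'n bit0. if (coord_basis j :: complex^'n) $ k \<noteq> 0 then r else 1)"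
  have "?A *v coord_basis j = d j *\<^sub>R coord_basis j" for j :: "'n bit0"
  proof -
    obtain i u where iu: "(coord_basis j :: complex^'n) = axis i u" "u \<noteq> 0"
      using coord_basis_in_Basis[of j] unfolding Basis_vec_def by (auto simp: Basis_complex_def)
    then have "d j = (if i = k then r else 1)" by (simp add: d_def axis_def)
    moreover have "?A *v axis i u = (if i = k then r else 1) *\<^sub>R axis i u"
      unfolding column_matrix_mult_vec by (simp add: vec_eq_iff axis_def scaleR_conv_of_real[where 'a=complex])
    ultimately show ?thesis using iu by simp
  qed
  then have "?A *v complexify x = complexify (\<chi> j. d j * x $ j)" for x
    by (simp add: complexify_def vec.linear_sum linear_sum[OF linear_matrix_vector_mult_real] 
        linear_scale[OF linear_matrix_vector_mult_real] mult.commute)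
  then have "real_matrix ?A *v x = (\<chi> j. d j * x $ j)" for x
    by (simp add: real_matrix_vector_mult)
  moreover have "(\<chi> i j. if i = j then d j else 0) *v x = (\<chi> j. d j * x $ j)" for x
    by (simp add: vec_eq_iff matrix_vector_mult_def if_distrib[of "\<lambda>y. y * _"] cong: if_cong)
  ultimately have "real_matrix ?A = (\<chi> i j. if i = j then d j else 0)"
    by (simp add: matrix_eq)
  then have "det (real_matrix ?A) = (\<Prod>j\<in>UNIV. d j)"
    by (simp add: det_diagonal)
  also have "\<dots> = (\<Prod>b\<in>(Basis :: (complex^'n) set). if b $ k \<noteq> 0 then r else 1)"
    unfolding d_def by (rule prod.reindex_bij_betw[OF bij_betw_coord_basis])
  also have "\<dots> = (\<Prod>b\<in>{b\<in>(Basis :: (complex^'n) set). b $ k \<noteq> 0}. r)"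
    by (intro prod.inter_filter[symmetric]) auto
  also have "{b\<in>(Basis :: (complex^'n) set). b $ k \<noteq> 0} = {axis k 1, axis k \<i>}"
  proof -
    have ax: "axis i u $ k = (if k = i then u else 0)" for i and u :: complex
      by (simp add: axis_def)
    show ?thesis
      unfolding Basis_vec_def Basis_complex_def by (auto simp: ax split: if_splits)
  qed
  also have "(\<Prod>b\<in>{axis k 1, axis k \<i>}. r) = r\<^sup>2"
    by (simp add: axis_eq_axis power2_eq_square complex_eq_iff)
  finally show ?thesis using assms by (simp add: rdet_def)
qed

lemma rdet_norm_preserving:
  assumes "\<And>x. norm (A *v x) = norm x" shows "rdet A = 1"
proof -
  have "orthogonal_transformation ((*v) (real_matrix A))"
    unfolding orthogonal_transformation
    by (simp add: real_matrix_vector_mult norm_realify assms)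
       (metis complexify_realify norm_realify realify_complexify)
  then have "orthogonal_matrix (real_matrix A)"
    by (simp add: orthogonal_transformation_matrix)
  from det_orthogonal_matrix[OF this] show ?thesis by (auto simp: rdet_def)
qed

lemma rdet_phase_axis:
  fixes k :: "'n::finite"
  shows "rdet (column_matrix k (axis k (cis \<theta>))) = 1"
proof (rule rdet_norm_preserving)
  fix x :: "complex^'n"
  have "cmod ((column_matrix k (axis k (cis \<theta>)) *v x) $ i) = cmod (x $ i)" for i
    by (simp add: column_matrix_mult_vec axis_def norm_mult)
  then show "norm (column_matrix k (axis k (cis \<theta>)) *v x) = norm x"
    by (simp add: norm_vec_def)
qed

text \<open>Real determinants of shears need no computation: a shear is conjugate to its square, so the
  multiplicative \<open>rdet\<close> satisfies \<open>r = r\<^sup>2\<close> on it, and it is invertible.\<close>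

lemma rdet_shear:
  assumes "a $ k = 1" shows "rdet (column_matrix k a) = 1"
proof -
  let ?U = "column_matrix k a" and ?D = "column_matrix k (axis k (complex_of_real (1/2)))"
  \<comment> \<open>Halving the coordinate \<open>k\<close> doubles the off-diagonal entries: \<open>D U D\<^sup>-\<^sup>1 = U\<^sup>2\<close>.\<close>
  have "?D ** ?U = ?U ** (?U ** ?D)"
    unfolding column_matrix_mult
    by (rule arg_cong[of _ _ "column_matrix k"]) (auto simp: column_matrix_mult_vec vec_eq_iff assms axis_def)
  then have "rdet ?D * rdet ?U = rdet ?U * (rdet ?U * rdet ?D)"
    by (metis rdet_mult)
  moreover have "rdet ?D = (1/2)\<^sup>2" by (rule rdet_scale_axis) simp
  moreover have "rdet ?U \<noteq> 0"
  proof -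
    have "?U ** column_matrix k (2 *s axis k 1 - a) = mat 1"
      unfolding column_matrix_mult column_matrix_axis[of k, symmetric]
      by (rule arg_cong[of _ _ "column_matrix k"]) (auto simp: column_matrix_mult_vec vec_eq_iff assms axis_def)
    then have "rdet ?U * rdet (column_matrix k (2 *s axis k 1 - a)) = 1"
      by (metis rdet_mult rdet_id)
    then show ?thesis by auto
  qed
  ultimately show ?thesis by auto
qed

text \<open>Factor the matrix into a shear, a positive scaling and a rotation of one coordinate.\<close>

lemma rdet_column_matrix:
  assumes "a $ k \<noteq> 0" shows "rdet (column_matrix k a) = (cmod (a $ k))\<^sup>2"
proof -
  let ?c = "a $ k"
  have "column_matrix k a = column_matrix k ((1 / ?c) *s a) ** (column_matrix k (axis k (complex_of_real (cmod ?c)))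
       ** column_matrix k (axis k (cis (Arg ?c))))"
    unfolding column_matrix_mult
    by (rule arg_cong[of _ _ "column_matrix k"])
       (use assms in \<open>auto simp: column_matrix_mult_vec vec_eq_iff axis_def cis_Arg sgn_eq\<close>)
  then have "rdet (column_matrix k a) = rdet (column_matrix k ((1 / ?c) *s a)) * ((cmod ?c)\<^sup>2 * 1)"
    using rdet_scale_axis[of "cmod ?c" k] assms
    by (metis rdet_mult rdet_phase_axis zero_less_norm_iff)
  also have "rdet (column_matrix k ((1 / ?c) *s a)) = 1"
    by (rule rdet_shear) (use assms in auto)
  finally show ?thesis by simp
qed

lemma column_matrix_fixes_axis: "j \<noteq> k \<Longrightarrow> column_matrix k a *v axis j 1 = axis j 1"
  by (auto simp: column_matrix_mult_vec vec_eq_iff axis_def)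

lemma column_matrix_inverse:
  assumes "a $ k \<noteq> 0"
  obtains b where "column_matrix k a ** column_matrix k b = mat 1" "column_matrix k b ** column_matrix k a = mat 1"
     "column_matrix k b *v a = axis k 1"
proof -
  define b where "b = (\<chi> i. if i = k then 1 / a $ k else - a $ i / a $ k)"
  have 1: "column_matrix k b *v a = axis k 1" and 2: "column_matrix k a *v b = axis k 1"
    using assms by (auto simp: b_def column_matrix_mult_vec vec_eq_iff axis_def)
  show ?thesis
    by (rule that[of b]) (simp_all add: column_matrix_mult 1 2 column_matrix_axis)
qed

text \<open>Gaussian elimination: both sides are multiplicative and agree on elementary matrices. The set \<open>K\<close>
  holds the columns that are not yet unit vectors.\<close>

lemma rdet_eq_of_inj:
  assumes "finite K" "\<And>x. A *v x = 0 \<Longrightarrow> x = 0" "\<And>j. j \<notin> K \<Longrightarrow> A *v axis j 1 = axis j 1"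
  shows "rdet A = (cmod (det A))\<^sup>2"
  using assms
proof (induction K arbitrary: A rule: finite_induct)
  case empty
  have "(A *v axis j 1) $ i = A $ i $ j" for i j
    by (simp add: matrix_vector_mult_def axis_def if_distrib[of "\<lambda>y. _ * y"] cong: if_cong)
  then have "A $ i $ j = axis j 1 $ i" for i j using empty(2)[of j] by (metis empty_iff)
  then have "A = mat 1" by (simp add: vec_eq_iff mat_def axis_def eq_commute)
  then show ?case by (simp add: rdet_id)
next
  case (insert k K)
  \<comment> \<open>With a nonzero pivot, the elimination matrix built from column \<open>k\<close> turns that column into
    a unit vector and leaves the finished columns alone.\<close>
  have main: "rdet A = (cmod (det A))\<^sup>2"
    if inj: "\<And>x. A *v x = 0 \<Longrightarrow> x = 0" and fixax: "\<And>j. j \<notin> insert k K \<Longrightarrow> A *v axis j 1 = axis j 1"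
     and nz: "(A *v axis k 1) $ k \<noteq> 0" for A
  proof -
    let ?a = "A *v axis k 1"
    obtain b where b: "column_matrix k ?a ** column_matrix k b = mat 1" 
      "column_matrix k b ** column_matrix k ?a = mat 1" "column_matrix k b *v ?a = axis k 1"
      using column_matrix_inverse[OF nz] by metis
    let ?B = "column_matrix k b ** A"
    have AB: "A = column_matrix k ?a ** ?B" by (metis b(1) matrix_mul_assoc matrix_mul_lid)
    have "rdet ?B = (cmod (det ?B))\<^sup>2"
    proof (rule insert.IH)
      fix x assume "?B *v x = 0"
      then have "A *v x = 0" by (metis AB matrix_vector_mul_assoc matrix_vector_mult_0_right)
      then show "x = 0" by (rule inj)
    next
      fix j assume "j \<notin> K"
      then show "?B *v axis j 1 = axis j 1"
        using b(3) fixax[of j] column_matrix_fixes_axis[of j k b]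
        by (cases "j = k") (auto simp: matrix_vector_mul_assoc[symmetric])
    qed
    then show ?thesis
      by (subst AB, subst (2) AB)
         (simp add: rdet_mult det_mul rdet_column_matrix[OF nz] det_column_matrix norm_mult power_mult_distrib del: matrix_vector_mul_assoc)
  qed
  show ?case
  proof (cases "(A *v axis k 1) $ k = 0")
    case False
    then show ?thesis using main insert.prems by blast
  next
    case True
    let ?a = "A *v axis k 1"
    have "\<exists>i\<in>K. ?a $ i \<noteq> 0"
    proof (rule ccontr)
      assume no: "\<not> (\<exists>i\<in>K. ?a $ i \<noteq> 0)"
      have ai: "?a $ i = 0" if "i \<in> insert k K" for i using no True that by auto
      have "A *v ?a = ?a"
      proof -
        have "?a = (\<Sum>i\<in>UNIV. ?a $ i *s axis i 1)" by (simp add: basis_expansion)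
        then have "A *v ?a = (\<Sum>i\<in>UNIV. ?a $ i *s (A *v axis i 1))"
          using vec.sum[of A "\<lambda>i. ?a $ i *s axis i 1" UNIV] by (simp add: vector_scalar_commute)
        also have "\<dots> = (\<Sum>i\<in>UNIV. ?a $ i *s axis i 1)"
        proof (intro sum.cong refl)
          fix i show "?a $ i *s (A *v axis i 1) = ?a $ i *s axis i 1"
            using ai[of i] insert.prems(2)[of i] by (cases "i \<in> insert k K") auto
        qed
        finally show ?thesis by (simp add: basis_expansion)
      qed
      then have "A *v (?a - axis k 1) = 0" by (simp add: matrix_vector_mult_diff_distrib)
      then have "?a = axis k 1" using insert.prems(1) by (metis eq_iff_diff_eq_0)
      then show False using True by (simp add: axis_def)
    qed
    then obtain i where i: "i \<in> K" "?a $ i \<noteq> 0" "i \<noteq> k" using True by auto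
    \<comment> \<open>Adding row \<open>i\<close> to row \<open>k\<close> makes the pivot nonzero; \<open>i \<in> K\<close> keeps the finished columns.\<close>
    define s where "s = (axis i 1 + axis k 1 :: complex^'a)"
    have si: "s $ i = 1" using i by (simp add: s_def axis_def)
    obtain b where b: "column_matrix i s ** column_matrix i b = mat 1" 
      "column_matrix i b ** column_matrix i s = mat 1"
      using column_matrix_inverse[of s i] si by (metis one_neq_zero)
    let ?B = "column_matrix i s ** A"
    have "rdet ?B = (cmod (det ?B))\<^sup>2"
    proof (rule main)
      fix x assume "?B *v x = 0"
      then have "A *v x = 0" 
        by (metis b(2) matrix_mul_lid matrix_vector_mul_assoc matrix_vector_mult_0_right)
      then show "x = 0" by (rule insert.prems)
    next
      fix j assume "j \<notin> insert k K"
      then show "?B *v axis j 1 = axis j 1"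
        using insert.prems(2)[of j] column_matrix_fixes_axis[of j i s] i
        by (auto simp: matrix_vector_mul_assoc[symmetric])
    next
      have "(?B *v axis k 1) $ k = ?a $ i"
        using True i by (simp add: matrix_vector_mul_assoc[symmetric] column_matrix_mult_vec s_def axis_def)
      then show "(?B *v axis k 1) $ k \<noteq> 0" using i by simp
    qed
    then show ?thesis using rdet_shear[of s i, OF si] 
      by (simp add: rdet_mult det_mul det_column_matrix si)
  qed
qed

text \<open>A complex matrix and its realification are singular together; elimination handles the other matrices.\<close>

proposition abs_det_real_matrix: "\<bar>det (real_matrix A)\<bar> = (cmod (det A))\<^sup>2"
proof (cases "\<exists>x. x \<noteq> 0 \<and> A *v x = 0")
  case False
  then have "rdet A = (cmod (det A))\<^sup>2" by (intro rdet_eq_of_inj[of UNIV]) auto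
  then show ?thesis by (simp add: rdet_def)
next
  case True
  then obtain x where x: "x \<noteq> 0" "A *v x = 0" by blast
  then have "\<not> invertible A"
    by (metis invertible_left_inverse matrix_left_invertible_ker)
  moreover have "real_matrix A *v realify x = 0" 
    using x by (simp add: real_matrix_vector_mult linear_0[OF linear_realify])
  moreover have "realify x \<noteq> 0" using x by (metis norm_realify norm_eq_zero)
  ultimately show ?thesis
    by (metis abs_zero invertible_det_nz invertible_left_inverse matrix_left_invertible_ker norm_zero zero_power2)
qed

section \<open>Volumes of holomorphic images\<close>

lemma has_derivative_realify: "(realify has_derivative realify) F"
  using linear_realify bounded_linear_imp_has_derivative linear_conv_bounded_linear by blast

lemma has_derivative_complexify: "(complexify has_derivative complexify) F"
  using linear_complexify bounded_linear_imp_has_derivative linear_conv_bounded_linear by blast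

lemma continuous_on_realify: "continuous_on A realify"
  using linear_realify linear_continuous_on linear_conv_bounded_linear by blast

lemma continuous_on_complexify: "continuous_on A complexify"
  using linear_complexify linear_continuous_on linear_conv_bounded_linear by blast

lemma borel_measurable_realify [measurable]: "realify \<in> borel \<rightarrow>\<^sub>M borel"
  by (rule borel_measurable_continuous_onI[OF continuous_on_realify])

lemma borel_measurable_complexify [measurable]: "complexify \<in> borel \<rightarrow>\<^sub>M borel"
  by (rule borel_measurable_continuous_onI[OF continuous_on_complexify])

lemma distr_realify: "distr lborel borel realify = (lborel :: (real^('n::finite bit0)) measure)"
proof (rule lborel_eqI[symmetric])
  fix l u :: "real^('n bit0)" assume lu: "\<And>b. b \<in> Basis \<Longrightarrow> l \<bullet> b \<le> u \<bullet> b"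
  have comp: "complexify x \<bullet> coord_basis j = x $ j" for x :: "real^('n bit0)" and j
    using realify_complexify[of x] by (metis realify_def vec_lambda_beta)
  have range: "(Basis :: (complex^'n) set) = range coord_basis"
    using bij_betw_coord_basis by (auto simp: bij_betw_def)
  have "realify -` box l u = box (complexify l) (complexify u)"
    by (auto simp: mem_box_cart mem_box range comp realify_def)
  then have "emeasure (distr lborel borel realify) (box l u) = emeasure lborel (box (complexify l) (complexify u))"
    by (simp add: emeasure_distr)
  also have "\<dots> = (\<Prod>b\<in>Basis. (complexify u - complexify l) \<bullet> b)"
  proof (rule emeasure_lborel_box)
    fix b :: "complex^'n" assume "b \<in> Basis"
    then obtain j where "b = coord_basis j" using range by blast
    then show "complexify l \<bullet> b \<le> complexify u \<bullet> b"
      using lu[of "axis j 1"] by (simp add: comp inner_axis)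
  qed
  also have "(\<Prod>b\<in>Basis. (complexify u - complexify l) \<bullet> b) = (\<Prod>j\<in>UNIV. u $ j - l $ j)"
    by (subst prod.reindex_bij_betw[OF bij_betw_coord_basis, symmetric]) (simp add: inner_diff_left comp)
  also have "\<dots> = (\<Prod>b\<in>Basis. (u - l) \<bullet> b)"
  proof -
    have "bij_betw (\<lambda>j. axis j (1::real)) (UNIV :: 'n bit0 set) Basis"
      by (auto simp: bij_betw_def inj_on_def axis_eq_axis Basis_vec_def)
    from prod.reindex_bij_betw[OF this, of "\<lambda>b. (u - l) \<bullet> b"] show ?thesis
      by (simp add: inner_axis)
  qed
  finally show "emeasure (distr lborel borel realify) (box l u) = (\<Prod>b\<in>Basis. (u - l) \<bullet> b)" .
qed simp

lemma holomorphic_map_has_derivative: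
  fixes \<phi> :: "complex^'n \<Rightarrow> complex^'m"
  assumes "holomorphic_map_on \<phi> D" "z \<in> D"
  shows "(\<phi> has_derivative (*v) (jacobian \<phi> (at z))) (at z)"
    and "frechet_derivative (\<lambda>z. \<phi> z $ i) (at z) v = (jacobian \<phi> (at z) *v v) $ i"
proof -
  let ?f = "\<lambda>i. frechet_derivative (\<lambda>z. \<phi> z $ i) (at z)"
  let ?F = "\<lambda>v. \<chi> i. ?f i v"
  have h: "holomorphic_fun_on (\<lambda>z. \<phi> z $ i) D" for i
    using assms by (simp add: holomorphic_map_on_def)
  note d = holomorphic_fun_on_frechet[OF h assms(2)]
  have F: "(\<phi> has_derivative ?F) (at z)"
    unfolding has_derivative_componentwise_within[of \<phi>]
  proof
    fix b :: "complex^'m" assume "b \<in> Basis"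
    then obtain i u where b: "b = axis i u" unfolding Basis_vec_def by auto
    from has_derivative_inner_left[OF d(1)[of i], of u]
    show "((\<lambda>x. \<phi> x \<bullet> b) has_derivative (\<lambda>x. ?F x \<bullet> b)) (at z)"
      by (simp add: b inner_axis)
  qed
  have lin: "?F v = jacobian \<phi> (at z) *v v" for v
  proof -
    have Ff: "frechet_derivative \<phi> (at z) = ?F" using F frechet_derivative_at by metis
    have "?F v = ?F (\<Sum>j\<in>UNIV. v $ j *s axis j 1)" by (simp add: basis_expansion)
    also have "\<dots> = (\<Sum>j\<in>UNIV. ?F (v $ j *s axis j 1))"
      by (rule linear_sum[OF has_derivative_linear[OF F]])
    also have "\<dots> = jacobian \<phi> (at z) *v v"
      unfolding jacobian_def Ff matrix_def matrix_vector_mult_def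
      by (simp add: vec_eq_iff d(2) mult.commute)
    finally show ?thesis .
  qed
  show "(\<phi> has_derivative (*v) (jacobian \<phi> (at z))) (at z)" using F lin by simp
  show "?f i v = (jacobian \<phi> (at z) *v v) $ i" using lin[of v, symmetric] by simp
qed

lemma jacobian_component:
  assumes "holomorphic_map_on \<phi> D" "z \<in> D"
  shows "jacobian \<phi> (at z) $ i $ j = frechet_derivative (\<lambda>z. \<phi> z $ i) (at z) (axis j 1)"
proof -
  have "(A *v axis j 1) $ i = A $ i $ j" for A :: "complex^'a^'b"
    by (simp add: matrix_vector_mult_def axis_def if_distrib[of "\<lambda>y. _ * y"] cong: if_cong)
  then show ?thesis unfolding holomorphic_map_has_derivative(2)[OF assms] by simp
qed

lemma continuous_on_jacobian_component:
  assumes "holomorphic_map_on \<phi> D" "open D"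
  shows "continuous_on D (\<lambda>z. jacobian \<phi> (at z) $ i $ j)"
proof -
  have "continuous_on D (\<lambda>z. frechet_derivative (\<lambda>z. \<phi> z $ i) (at z) (axis j 1))"
    using assms by (intro continuous_on_frechet_derivative) (auto simp: holomorphic_map_on_def)
  then show ?thesis 
    by (rule continuous_on_cong[THEN iffD1, rotated 2]) (auto simp: jacobian_component[OF assms(1)])
qed

lemma continuous_on_det_matrix:
  fixes A :: "'a::topological_space \<Rightarrow> complex^'n^'n"
  assumes "\<And>i j. continuous_on D (\<lambda>z. A z $ i $ j)"
  shows "continuous_on D (\<lambda>z. det (A z))"
  unfolding det_def by (intro continuous_intros assms)

lemma continuous_on_complex_jacobian:
  assumes "holomorphic_map_on \<phi> D" "open D"
  shows "continuous_on D (complex_jacobian \<phi>)"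
  unfolding complex_jacobian_def[abs_def]
  by (intro continuous_on_det_matrix continuous_on_jacobian_component[OF assms])

lemma holomorphic_map_on_imp_continuous_on:
  assumes "holomorphic_map_on \<phi> D" shows "continuous_on D \<phi>"
  using holomorphic_map_has_derivative(1)[OF assms]
  by (meson continuous_at_imp_continuous_on has_derivative_continuous)

lemma holomorphic_fun_on_compose_map:
  assumes "holomorphic_fun_on f D'" "holomorphic_map_on \<phi> D" "\<phi> \<in> D \<rightarrow> D'"
  shows "holomorphic_fun_on (\<lambda>z. f (\<phi> z)) D"
  unfolding holomorphic_fun_on_def
proof (intro ballI exI conjI allI)
  fix z assume z: "z \<in> D"
  then have "\<phi> z \<in> D'" using assms(3) by auto
  then show "((\<lambda>z. f (\<phi> z)) has_derivative
      (\<lambda>v. frechet_derivative f (at (\<phi> z)) (jacobian \<phi> (at z) *v v))) (at z)"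
    by (intro has_derivative_compose[OF holomorphic_map_has_derivative(1)[OF assms(2) z]]
         holomorphic_fun_on_frechet(1)[OF assms(1)])
  show "frechet_derivative f (at (\<phi> z)) (jacobian \<phi> (at z) *v (c *s v)) =
      c * frechet_derivative f (at (\<phi> z)) (jacobian \<phi> (at z) *v v)" for c v
    using \<open>\<phi> z \<in> D'\<close> by (simp add: vector_scalar_commute holomorphic_fun_on_frechet(2)[OF assms(1)])
qed

definition realify_map :: "(complex^'n \<Rightarrow> complex^'n) \<Rightarrow> real^('n::finite bit0) \<Rightarrow> real^('n bit0)" where
  "realify_map \<phi> = realify \<circ> \<phi> \<circ> complexify"

lemma realify_map_has_derivative:
  assumes "holomorphic_map_on \<phi> D" "complexify x \<in> D"
  shows "(realify_map \<phi> has_derivative (*v) (real_matrix (jacobian \<phi> (at (complexify x))))) (at x)"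
proof -
  have "((\<lambda>x. realify (\<phi> (complexify x))) has_derivative
      (\<lambda>v. realify (jacobian \<phi> (at (complexify x)) *v complexify v))) (at x)"
    by (rule has_derivative_compose[OF has_derivative_compose[OF has_derivative_complexify 
         holomorphic_map_has_derivative(1)[OF assms]] has_derivative_realify])
  then show ?thesis by (simp add: realify_map_def o_def real_matrix_vector_mult[abs_def])
qed

text \<open>On a compact set an injective continuous map has a continuous inverse, so it preserves Borel sets.\<close>

lemma inj_continuous_image_borel:
  fixes f :: "'a::euclidean_space \<Rightarrow> 'b::euclidean_space"
  assumes K: "compact K" "continuous_on K f" "inj_on f K" and S: "S \<subseteq> K" "S \<in> sets borel"
  shows "f ` S \<in> sets borel"
proof -
  obtain g where "homeomorphism K (f ` K) f g"
    using homeomorphism_compact[OF K(1,2) refl K(3)] by blast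
  then have g: "continuous_on (f ` K) g" "\<And>x. x \<in> K \<Longrightarrow> g (f x) = x"
    by (auto simp: homeomorphism_def)
  have K': "f ` K \<in> sets borel" by (intro borel_closed compact_imp_closed compact_continuous_image K)
  have "g \<in> borel_measurable (restrict_space borel (f ` K))"
    using g(1) by (rule borel_measurable_continuous_on_restrict)
  then have "g -` S \<inter> space (restrict_space borel (f ` K)) \<in> sets (restrict_space borel (f ` K))"
    using S(2) by (rule measurable_sets)
  then have "g -` S \<inter> f ` K \<in> sets borel" 
    using K' by (simp add: space_restrict_space sets_restrict_space_iff)
  moreover have "f ` S = g -` S \<inter> f ` K" using g(2) S(1) by (auto simp: image_iff) 
  ultimately show ?thesis by simp
qed

lemma borel_measurable_jacobian_weight:
  assumes "holomorphic_map_on \<phi> D" "open D" "S \<in> sets borel" "S \<subseteq> D"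
  shows "(\<lambda>z. ennreal ((cmod (complex_jacobian \<phi> z))\<^sup>2) * indicator S z) \<in> borel_measurable borel"
proof -
  have "continuous_on S (\<lambda>z. (cmod (complex_jacobian \<phi> z))\<^sup>2)"
    using continuous_on_subset[OF continuous_on_complex_jacobian[OF assms(1,2)] assms(4)]
    by (intro continuous_intros)
  from borel_measurable_continuous_on_indicator[OF assms(3) this]
  have "(\<lambda>z. ennreal (indicator S z *\<^sub>R (cmod (complex_jacobian \<phi> z))\<^sup>2)) \<in> borel_measurable borel"
    by simp
  also have "(\<lambda>z. ennreal (indicator S z *\<^sub>R (cmod (complex_jacobian \<phi> z))\<^sup>2)) =
     (\<lambda>z. ennreal ((cmod (complex_jacobian \<phi> z))\<^sup>2) * indicator S z)"
    by (auto simp: indicator_def)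
  finally show ?thesis .
qed

text \<open>The real change of variables formula, transported by \<open>realify\<close>. Working inside a compact set on which
  \<open>\<phi>\<close> is injective keeps the image Borel and bounded.\<close>

proposition emeasure_holomorphic_image:
  fixes \<phi> :: "complex^'n \<Rightarrow> complex^'n"
  assumes h: "holomorphic_map_on \<phi> D" "open D" and K: "compact K" "K \<subseteq> D" "inj_on \<phi> K"
    and S: "S \<subseteq> K" "S \<in> sets borel"
  shows "\<phi> ` S \<in> sets borel"
    and "emeasure lborel (\<phi> ` S) = (\<integral>\<^sup>+z. ennreal ((cmod (complex_jacobian \<phi> z))\<^sup>2) * indicator S z \<partial>lborel)"
proof -
  have contK: "continuous_on K \<phi>"
    using holomorphic_map_on_imp_continuous_on[OF h(1)] K(2) continuous_on_subset by blast
  show B: "\<phi> ` S \<in> sets borel"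
    by (rule inj_continuous_image_borel[OF K(1) contK K(3) S])
  let ?J = "\<lambda>z. (cmod (complex_jacobian \<phi> z))\<^sup>2"
  let ?g = "realify_map \<phi>"
  let ?S = "complexify -` S"
  have S': "?S \<in> sets borel" using measurable_sets[OF borel_measurable_complexify S(2)] by simp
  have im: "?g ` ?S = complexify -` (\<phi> ` S)"
  proof
    show "?g ` ?S \<subseteq> complexify -` (\<phi> ` S)" by (auto simp: realify_map_def)
    show "complexify -` (\<phi> ` S) \<subseteq> ?g ` ?S"
    proof
      fix x assume "x \<in> complexify -` (\<phi> ` S)"
      then obtain s where s: "s \<in> S" "complexify x = \<phi> s" by auto
      then have "x = ?g (realify s)" by (metis realify_map_def comp_apply complexify_realify realify_complexify)
      then show "x \<in> ?g ` ?S" using s by auto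
    qed
  qed
  have imB: "?g ` ?S \<in> sets borel" unfolding im using measurable_sets[OF borel_measurable_complexify B] by simp
  have "bounded (?g ` ?S)"
  proof -
    have "bounded (\<phi> ` S)"
      by (rule bounded_subset[OF compact_imp_bounded[OF compact_continuous_image[OF contK K(1)]] image_mono[OF S(1)]])
    moreover have "?g ` ?S \<subseteq> realify ` (\<phi> ` S)" by (auto simp: realify_map_def)
    ultimately show ?thesis
      by (metis bounded_linear_image bounded_subset linear_conv_bounded_linear linear_realify)
  qed
  then have lm: "?g ` ?S \<in> lmeasurable"
    using imB by (intro bounded_set_imp_lmeasurable) auto
  have inj: "inj_on ?g ?S"
    using K(3) S(1) unfolding inj_on_def realify_map_def
    by (metis comp_apply complexify_realify realify_complexify subsetD vimageE)
  have leb: "?S \<in> sets lebesgue" using S' by simp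
  have der: "(?g has_derivative (*v) (real_matrix (jacobian \<phi> (at (complexify x))))) (at x within ?S)"
    if "x \<in> ?S" for x
  proof -
    have "complexify x \<in> D" using that S(1) K(2) by blast
    then show ?thesis by (rule has_derivative_at_withinI[OF realify_map_has_derivative[OF h(1)]])
  qed
  have "((\<lambda>x. \<bar>det (matrix ((*v) (real_matrix (jacobian \<phi> (at (complexify x))))))\<bar>) has_integral
      measure lebesgue (?g ` ?S)) ?S"
    using lm by (intro has_measure_differentiable_image[OF leb der inj, THEN iffD1]) simp_all
  then have "((\<lambda>x. ?J (complexify x)) has_integral measure lebesgue (?g ` ?S)) ?S"
    by (simp add: abs_det_real_matrix complex_jacobian_def)
  from nn_integral_has_integral_lebesgue'[OF _ this]
  have "(\<integral>\<^sup>+x. ennreal (?J (complexify x)) * indicator ?S x \<partial>lborel) = ennreal (measure lebesgue (?g ` ?S))"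
    by simp
  also have "\<dots> = emeasure lebesgue (?g ` ?S)" using lm by (simp add: emeasure_eq_measure2)
  also have "\<dots> = emeasure lborel (?g ` ?S)" using imB by simp
  also have "\<dots> = emeasure (distr lborel borel realify) (?g ` ?S)" by (simp add: distr_realify)
  also have "\<dots> = emeasure lborel (realify -` ?g ` ?S)" using imB by (subst emeasure_distr) auto
  also have "realify -` ?g ` ?S = \<phi> ` S" unfolding im by auto
  finally have "emeasure lborel (\<phi> ` S) = (\<integral>\<^sup>+x. ennreal (?J (complexify x)) * indicator ?S x \<partial>lborel)" ..
  also have "\<dots> = (\<integral>\<^sup>+x. ennreal (?J (complexify x)) * indicator S (complexify x) \<partial>distr lborel borel realify)"
    by (simp add: distr_realify indicator_vimage[symmetric])
  also have "\<dots> = (\<integral>\<^sup>+z. ennreal (?J z) * indicator S z \<partial>lborel)"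
  proof -
    have [measurable]: "(\<lambda>z. ennreal (?J z) * indicator S z) \<in> borel_measurable borel"
      using borel_measurable_jacobian_weight[OF h S(2)] S(1) K(2) by blast
    have "(\<lambda>x. ennreal (?J (complexify x)) * indicator S (complexify x)) \<in> borel_measurable borel"
      using measurable_compose[OF borel_measurable_complexify \<open>(\<lambda>z. ennreal (?J z) * indicator S z) \<in> borel_measurable borel\<close>] .
    then show ?thesis by (subst nn_integral_distr) auto
  qed
  finally show "emeasure lborel (\<phi> ` S) = (\<integral>\<^sup>+z. ennreal (?J z) * indicator S z \<partial>lborel)" .
qed

text \<open>The easy case of the Morse-Sard theorem, for equal dimensions, transported by \<open>realify\<close>.\<close>

lemma AE_not_critical_value:
  fixes \<phi> :: "complex^'n \<Rightarrow> complex^'n"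
  assumes h: "holomorphic_map_on \<phi> D"
  shows "AE w in lborel. w \<notin> critical_values \<phi> D"
proof -
  let ?C = "{z \<in> D. complex_jacobian \<phi> z = 0}"
  have "negligible (realify_map \<phi> ` (complexify -` ?C))"
  proof (rule baby_Sard)
    fix x assume x: "x \<in> complexify -` ?C"
    then have xD: "complexify x \<in> D" by simp
    show "(realify_map \<phi> has_derivative (*v) (real_matrix (jacobian \<phi> (at (complexify x))))) (at x within complexify -` ?C)"
      by (rule has_derivative_at_withinI[OF realify_map_has_derivative[OF h xD]])
    have "\<bar>det (real_matrix (jacobian \<phi> (at (complexify x))))\<bar> = 0"
      using x unfolding abs_det_real_matrix complex_jacobian_def by simp
    then show "rank (matrix ((*v) (real_matrix (jacobian \<phi> (at (complexify x)))))) < CARD('n bit0)"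
      by (simp add: det_eq_0_rank)
  qed simp
  then obtain N where N: "N \<in> null_sets lborel" "realify_map \<phi> ` (complexify -` ?C) \<subseteq> N"
    by (auto simp: negligible_iff_null_sets null_sets_completion_iff2)
  have "realify -` N \<in> null_sets lborel"
  proof -
    have "emeasure (distr lborel borel realify) N = 0" using N by (simp add: distr_realify null_sets_def)
    moreover have "realify -` N \<in> sets borel"
      using measurable_sets[OF borel_measurable_realify, of N] N by (simp add: null_sets_def)
    ultimately show ?thesis using N by (auto simp: emeasure_distr null_sets_def)
  qed
  moreover have "w \<in> realify -` N" if w: "w \<in> critical_values \<phi> D" for w
  proof -
    obtain z where z: "z \<in> ?C" "w = \<phi> z" using w by (auto simp: critical_values_def)
    then have "realify w = realify_map \<phi> (realify z)" by (simp add: realify_map_def)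
    moreover have "realify z \<in> complexify -` ?C" using z by simp
    ultimately show ?thesis using N(2) by blast
  qed
  ultimately show ?thesis by (intro AE_I'[of "realify -` N"]) auto
qed

section \<open>The Jacobian of a proper holomorphic map\<close>

text \<open>The inverse function theorem, with the continuity of the derivative supplied by the Cauchy inequality.\<close>

lemma holomorphic_local_inverse:
  fixes \<psi> :: "complex^'n \<Rightarrow> complex^'n"
  assumes h: "holomorphic_map_on \<psi> D" "open D" and a: "a \<in> D" "complex_jacobian \<psi> a \<noteq> 0"
  obtains U V g where "open U" "a \<in> U" "U \<subseteq> D" "open V" "\<psi> a \<in> V" "homeomorphism U V \<psi> g"
    "\<And>y. y \<in> V \<Longrightarrow> (g has_derivative inv ((*v) (jacobian \<psi> (at (g y))))) (at y)"
    "\<And>y. y \<in> V \<Longrightarrow> bij ((*v) (jacobian \<psi> (at (g y))))"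
proof -
  let ?N = "\<lambda>z. jacobian \<psi> (at z)"
  let ?B = "\<lambda>z. Blinfun ((*v) (?N z))"
  have bl: "bounded_linear ((*v) A)" for A :: "complex^'n^'n"
    using linear_matrix_vector_mult_real linear_conv_bounded_linear by blast
  have Bapp: "blinfun_apply (?B z) = (*v) (?N z)" for z
    by (rule bounded_linear_Blinfun_apply[OF bl])
  obtain C where C: "C ** ?N a = mat 1"
    using a(2) unfolding complex_jacobian_def by (metis invertible_det_nz invertible_left_inverse)
  show ?thesis
  proof (rule inverse_function_theorem[OF h(2), of \<psi> ?B a "Blinfun ((*v) C)"])
    show "(\<psi> has_derivative blinfun_apply (?B x)) (at x)" if "x \<in> D" for x
      unfolding Bapp by (rule holomorphic_map_has_derivative(1)[OF h(1) that])
    show "continuous_on D ?B"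
    proof (rule continuous_on_blinfun_componentwise)
      fix i :: "complex^'n"
      show "continuous_on D (\<lambda>z. blinfun_apply (?B z) i)"
        unfolding Bapp matrix_vector_mult_def
        by (intro continuous_intros continuous_on_jacobian_component[OF h])
    qed
    show "Blinfun ((*v) C) o\<^sub>L ?B a = id_blinfun"
      by (rule blinfun_eqI) (simp add: Bapp bounded_linear_Blinfun_apply[OF bl] matrix_vector_mul_assoc C)
  qed (use a that in \<open>auto simp: Bapp\<close>)
qed

lemma generalized_inverse_matrix:
  fixes M :: "complex^'n^'n"
  obtains G where "M ** G ** M = M" "G ** M ** G = G"
proof -
  obtain g where g: "Vector_Spaces.linear (*s) (*s) g" "\<And>v. M *v (g (M *v v)) = M *v v"
    using vec.linear_exists_right_inverse_on[OF matrix_vector_mul_linear_gen vec.subspace_UNIV, of M] by auto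
  \<comment> \<open>\<open>G\<close> satisfies the first equation; \<open>G M G\<close> satisfies both.\<close>
  define G where "G = matrix g"
  have 1: "M ** (G ** M) = M"
    unfolding matrix_eq by (simp add: matrix_vector_mul_assoc[symmetric] G_def matrix_works[OF g(1)] g(2))
  then have 1: "M ** (G ** (M ** X)) = M ** X" for X by (metis matrix_mul_assoc)
  show ?thesis
    by (rule that[of "G ** (M ** G)"])
       (use 1[of G] 1[of "mat 1"] in \<open>simp_all add: matrix_mul_assoc[symmetric]\<close>)
qed

lemma holomorphic_map_on_linear_combination:
  fixes \<phi> :: "complex^'n \<Rightarrow> complex^'m"
  assumes "holomorphic_map_on \<phi> D"
  shows "holomorphic_map_on (\<lambda>z. G *v \<phi> z + P *v z) D"
    and "z \<in> D \<Longrightarrow> jacobian (\<lambda>z. G *v \<phi> z + P *v z) (at z) = G ** jacobian \<phi> (at z) + P"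
proof -
  have blm: "bounded_linear ((*v) A)" for A :: "complex^'k^'j"
    using linear_matrix_vector_mult_real linear_conv_bounded_linear by blast
  have d: "((\<lambda>z. G *v \<phi> z + P *v z) has_derivative (*v) (G ** jacobian \<phi> (at z) + P)) (at z)" if z: "z \<in> D" for z
  proof -
    have "((\<lambda>z. G *v \<phi> z + P *v z) has_derivative (\<lambda>v. G *v (jacobian \<phi> (at z) *v v) + P *v v)) (at z)"
      by (intro has_derivative_add bounded_linear.has_derivative[OF blm] has_derivative_ident
           holomorphic_map_has_derivative(1)[OF assms z])
    moreover have "(\<lambda>v. G *v (jacobian \<phi> (at z) *v v) + P *v v) = (*v) (G ** jacobian \<phi> (at z) + P)"
      by (rule ext) (simp add: matrix_vector_mul_assoc matrix_vector_mult_add_rdistrib)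
    ultimately show ?thesis by simp
  qed
  show "z \<in> D \<Longrightarrow> jacobian (\<lambda>z. G *v \<phi> z + P *v z) (at z) = G ** jacobian \<phi> (at z) + P"
    by (simp only: jacobian_def[of "\<lambda>z. G *v \<phi> z + P *v z"] frechet_derivative_at[OF d, symmetric] matrix_of_matrix_vector_mul)
  show "holomorphic_map_on (\<lambda>z. G *v \<phi> z + P *v z) D"
    unfolding holomorphic_map_on_def holomorphic_fun_on_def
  proof (intro allI ballI exI conjI)
    fix i z assume "z \<in> D"
    show "((\<lambda>z. (G *v \<phi> z + P *v z) $ i) has_derivative
        (\<lambda>v. ((G ** jacobian \<phi> (at z) + P) *v v) $ i)) (at z)"
      by (rule bounded_linear.has_derivative[OF bounded_linear_vec_nth d[OF \<open>z \<in> D\<close>]])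
  qed (simp add: vector_scalar_commute)
qed

lemma inner_complex_vec: "(z :: complex^'n) \<bullet> a = Re (\<Sum>i\<in>UNIV. z $ i * cnj (a $ i))"
  by (simp add: inner_vec_def inner_complex_def)

lemma holomorphic_on_det:
  fixes A :: "complex \<Rightarrow> complex^'n^'n"
  assumes "\<And>i j. (\<lambda>t. A t $ i $ j) holomorphic_on S"
  shows "(\<lambda>t. det (A t)) holomorphic_on S"
  unfolding det_def by (intro holomorphic_intros assms)

text \<open>The constant rank theorem in the form needed below, without charts on both sides. Let \<open>z0\<close> be a point
  where the kernel of the derivative of \<open>\<phi>\<close> has minimal dimension, with generalized inverse \<open>G\<close> of the
  derivative there, so that \<open>P\<close> is a projection onto that kernel. The map \<open>\<psi> z = G \<phi>(z) + P z\<close> has derivative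
  \<open>1\<close> at \<open>z0\<close> and is a local coordinate system at each \<open>a\<close> with \<open>det (\<psi>' a) \<noteq> 0\<close>. In these coordinates \<open>\<phi>\<close>
  does not change in the direction of a kernel vector \<open>x\<close>, so the coordinate line in direction \<open>x\<close> is a
  disc in the fibre of \<open>a\<close>.\<close>

lemma holomorphic_disc_in_fibre:
  fixes \<phi> :: "complex^'n \<Rightarrow> complex^'n"
  assumes h: "holomorphic_map_on \<phi> D" "open D"
    and z0: "\<And>z. z \<in> D \<Longrightarrow> vec.dim {v. jacobian \<phi> (at z0) *v v = 0} \<le> vec.dim {v. jacobian \<phi> (at z) *v v = 0}"
    and G: "jacobian \<phi> (at z0) ** G ** jacobian \<phi> (at z0) = jacobian \<phi> (at z0)"
      "G ** jacobian \<phi> (at z0) ** G = G"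
    and P: "P = mat 1 - G ** jacobian \<phi> (at z0)"
    and a: "a \<in> D" "det (G ** jacobian \<phi> (at a) + P) \<noteq> 0"
    and x: "jacobian \<phi> (at z0) *v x = 0"
  obtains r c c' where "r > 0" "c 0 = a" "\<And>t. t \<in> ball 0 r \<Longrightarrow> c t \<in> D \<and> \<phi> (c t) = \<phi> a"
    "\<And>t. t \<in> ball 0 r \<Longrightarrow> (c has_derivative (\<lambda>h. h *s c' t)) (at t)"
    "\<And>t. t \<in> ball 0 r \<Longrightarrow> c t = a \<Longrightarrow> t *s x = 0"
proof -
  let ?M = "\<lambda>z. jacobian \<phi> (at z)"
  let ?A = "jacobian \<phi> (at z0)"
  let ?N = "\<lambda>z. G ** ?M z + P"
  define \<psi> where "\<psi> = (\<lambda>z. G *v \<phi> z + P *v z)"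
  have h\<psi>: "holomorphic_map_on \<psi> D" "\<And>z. z \<in> D \<Longrightarrow> jacobian \<psi> (at z) = ?N z"
    unfolding \<psi>_def using holomorphic_map_on_linear_combination[OF h(1)] by blast+
  have Pv: "P *v v = v - G *v (?A *v v)" for v
    by (simp add: P matrix_vector_mult_diff_rdistrib matrix_vector_mul_assoc)
  have Gv: "G *v (?A *v (G *v v)) = G *v v" and Av: "?A *v (G *v (?A *v v)) = ?A *v v" for v
    using G by (metis matrix_vector_mul_assoc)+
  have PG: "P *v (G *v v) = 0" and PP: "P *v (P *v v) = P *v v" and MP: "?A *v (P *v v) = 0" for v
    by (simp_all add: Pv Gv Av matrix_vector_mult_diff_distrib)
  have Px: "P *v x = x" using x by (simp add: Pv)
  \<comment> \<open>The vector mapped to \<open>x\<close> by the derivative of \<open>\<psi>\<close> lies in the kernel of \<open>G M\<close>, where \<open>M\<close> is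
    the derivative of \<open>\<phi>\<close>. This kernel is the kernel of \<open>M\<close>: it contains the latter, and \<open>P\<close> maps it
    injectively into the kernel at \<open>z0\<close>, which has minimal dimension, since \<open>P\<close> and the injective
    derivative of \<open>\<psi>\<close> agree on it.\<close>
  have ker: "?M z *v w = 0" if z: "z \<in> D" "inj ((*v) (?N z))" and w: "?N z *v w = x" for z w
  proof -
    have split: "?N z *v v = G *v (?M z *v v) + P *v v" for v
      by (simp add: matrix_vector_mul_assoc matrix_vector_mult_add_rdistrib)
    have "P *v (?N z *v w) = P *v w"
      unfolding split by (simp add: matrix_vector_right_distrib PG PP)
    then have "P *v w = x" using w Px by simp
    then have Gw: "G *v (?M z *v w) = 0" using w split[of w] by simp
    let ?K = "{v. ?M z *v v = 0}" and ?L = "{v. G *v (?M z *v v) = 0}"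
    have "vec.subspace ?K"
      by (auto simp: vec.subspace_def matrix_vector_right_distrib vector_scalar_commute)
    moreover have sL: "vec.subspace ?L"
      by (auto simp: vec.subspace_def matrix_vector_right_distrib vector_scalar_commute)
    moreover have "?K \<subseteq> ?L" by auto
    moreover have "vec.dim ?L \<le> vec.dim ?K"
    proof -
      have PL: "P *v v = ?N z *v v" if "v \<in> ?L" for v using that by (simp add: split)
      have "inj_on ((*v) P) (vec.span ?L)"
      proof (rule inj_onI)
        fix u v assume uv: "u \<in> vec.span ?L" "v \<in> vec.span ?L" "P *v u = P *v v"
        have "vec.span ?L \<subseteq> ?L" by (rule vec.span_minimal[OF subset_refl sL])
        then have "u \<in> ?L" "v \<in> ?L" using uv(1,2) by (meson subsetD)+
        then show "u = v" using PL uv(3) z(2) by (metis injD)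
      qed
      then have "vec.dim ?L = vec.dim ((*v) P ` ?L)"
        by (rule vec.dim_image_eq[OF matrix_vector_mul_linear_gen, symmetric])
      also have "\<dots> \<le> vec.dim {v. ?A *v v = 0}"
        by (rule vec.dim_subset) (auto simp: MP)
      also have "\<dots> \<le> vec.dim ?K" by (rule z0[OF z(1)])
      finally show ?thesis .
    qed
    ultimately have "?K = ?L" by (rule vec.subspace_dim_equal)
    then show ?thesis using Gw by blast
  qed
  have "complex_jacobian \<psi> a \<noteq> 0" using a h\<psi>(2) by (simp add: complex_jacobian_def)
  then obtain U V g where UV: "open U" "a \<in> U" "U \<subseteq> D" "open V" "\<psi> a \<in> V" "homeomorphism U V \<psi> g"
    and dg: "\<And>y. y \<in> V \<Longrightarrow> (g has_derivative inv ((*v) (jacobian \<psi> (at (g y))))) (at y)"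
    and bij: "\<And>y. y \<in> V \<Longrightarrow> bij ((*v) (jacobian \<psi> (at (g y))))"
    using holomorphic_local_inverse[OF h\<psi>(1) h(2) a(1)] by blast
  let ?l = "\<lambda>t. \<psi> a + t *s x"
  have "continuous_on UNIV ?l"
    by (intro continuous_at_imp_continuous_on ballI has_derivative_continuous[OF line_has_derivative])
  then have "open (?l -` V)" by (intro open_vimage UV(4))
  moreover have "0 \<in> ?l -` V" using UV(5) by simp
  ultimately obtain r where r: "r > 0" "ball 0 r \<subseteq> ?l -` V" using openE by blast
  define c where "c = (\<lambda>t. g (?l t))"
  define c' where "c' = (\<lambda>t. inv ((*v) (?N (c t))) x)"
  have lV: "?l t \<in> V" if "t \<in> ball 0 r" for t using r(2) that by blast
  have cU: "c t \<in> D" "\<psi> (c t) = ?l t" if "t \<in> ball 0 r" for t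
    using UV(3,6) lV[OF that] by (auto simp: c_def homeomorphism_def)
  have ga: "g (\<psi> a) = a" using UV(2,6) by (simp add: homeomorphism_def)
  have bijN: "bij ((*v) (?N (c t)))" if "t \<in> ball 0 r" for t
    using bij[OF lV[OF that]] h\<psi>(2)[OF cU(1)[OF that]] by (simp add: c_def)
  have Nc': "?N (c t) *v c' t = x" if "t \<in> ball 0 r" for t
    using bijN[OF that] by (simp add: c'_def bij_is_surj surj_f_inv_f)
  have dc: "(c has_derivative (\<lambda>h. h *s c' t)) (at t)" if t: "t \<in> ball 0 r" for t
  proof -
    have "(c has_derivative (\<lambda>h. inv ((*v) (?N (c t))) (h *s x))) (at t)"
      using has_derivative_compose[OF line_has_derivative dg[OF lV[OF t]]] h\<psi>(2)[OF cU(1)[OF t]]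
      by (simp add: c_def)
    moreover have "inv ((*v) (?N (c t))) (h *s x) = h *s c' t" for h
      using bijN[OF t] Nc'[OF t] by (intro inv_f_eq) (auto simp: bij_is_inj vector_scalar_commute)
    ultimately show ?thesis by simp
  qed
  have "\<exists>k. \<forall>t\<in>ball 0 r. \<phi> (c t) = k"
  proof (rule has_derivative_zero_constant)
    fix t :: complex assume t: "t \<in> ball 0 r"
    have "((\<lambda>t. \<phi> (c t)) has_derivative (\<lambda>h. ?M (c t) *v (h *s c' t))) (at t)"
      by (rule has_derivative_compose[OF dc[OF t] holomorphic_map_has_derivative(1)[OF h(1) cU(1)[OF t]]])
    moreover have "?M (c t) *v (h *s c' t) = 0" for h
      using ker[OF cU(1)[OF t] bij_is_inj[OF bijN[OF t]] Nc'[OF t]] by (simp add: vector_scalar_commute)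
    ultimately show "((\<lambda>t. \<phi> (c t)) has_derivative (\<lambda>h. 0)) (at t within ball 0 r)"
      by (simp add: has_derivative_at_withinI)
  qed simp
  then have const: "\<phi> (c t) = \<phi> (c 0)" if "t \<in> ball 0 r" for t using that r(1) by (metis centre_in_ball)
  have c0: "c 0 = a" using ga by (simp add: c_def)
  show ?thesis
  proof (rule that[of r c c', OF r(1) c0])
    fix t :: complex assume t: "t \<in> ball 0 r"
    show "c t \<in> D \<and> \<phi> (c t) = \<phi> a" using cU(1)[OF t] const[OF t] c0 by simp
    show "(c has_derivative (\<lambda>h. h *s c' t)) (at t)" by (rule dc[OF t])
    show "t *s x = 0" if "c t = a" using cU(2)[OF t] that by simp
  qed
qed

text \<open>Suppose the Jacobian vanishes identically, so that all kernels are nontrivial. Let \<open>\<gamma>\<close> be the determinant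
  of \<open>G \<phi>' + P\<close>; \<open>holomorphic_disc_in_fibre\<close> applies where it is nonzero, and it equals \<open>1\<close> at \<open>z0\<close>. On the
  compact fibre of \<open>z0\<close>, the function \<open>\<bar>\<gamma>\<bar> * exp (\<bar>z\<bar>\<^sup>2 / 2)\<close> attains its maximum, at a point \<open>a\<close> with
  \<open>\<gamma> a \<noteq> 0\<close>. The logarithm of this function is strictly plurisubharmonic near \<open>a\<close>, so it cannot have
  a maximum along a nonconstant disc through \<open>a\<close> in the fibre. The factor \<open>\<bar>\<gamma>\<bar>\<close> is what keeps \<open>a\<close> away from
  the points of lower rank, where the fibre may be singular.\<close>

proposition proper_holomorphic_map_jacobian_nonzero:
  fixes \<phi> :: "complex^'n \<Rightarrow> complex^'n"
  assumes p: "proper_holomorphic_map D D' \<phi>" and D: "open D" "D \<noteq> {}"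
  shows "\<exists>z\<in>D. complex_jacobian \<phi> z \<noteq> 0"
proof (rule ccontr)
  assume "\<not> ?thesis"
  then have J0: "det (jacobian \<phi> (at z)) = 0" if "z \<in> D" for z using that by (auto simp: complex_jacobian_def)
  have h: "holomorphic_map_on \<phi> D" and \<phi>: "\<phi> \<in> D \<rightarrow> D'" and pm: "proper_map (top_of_set D) (top_of_set D') \<phi>"
    using p by (auto simp: proper_holomorphic_map_def)
  let ?M = "\<lambda>z. jacobian \<phi> (at z)"
  obtain z0 where z0: "z0 \<in> D"
    "\<And>z. z \<in> D \<Longrightarrow> vec.dim {v. ?M z0 *v v = 0} \<le> vec.dim {v. ?M z *v v = 0}"
  proof -
    obtain z1 where "z1 \<in> D" using D(2) by blast
    from ex_has_least_nat[of "\<lambda>z. z \<in> D", OF this, of "\<lambda>z. vec.dim {v. ?M z *v v = 0}"]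
    show ?thesis using that by auto
  qed
  obtain G where G: "?M z0 ** G ** ?M z0 = ?M z0" "G ** ?M z0 ** G = G"
    using generalized_inverse_matrix by blast
  define P where "P = mat 1 - G ** ?M z0"
  define \<gamma> where "\<gamma> = (\<lambda>z. det (G ** ?M z + P))"
  have \<gamma>0: "\<gamma> z0 = 1" by (simp add: \<gamma>_def P_def)
  have entry: "(G ** ?M z + P) $ i $ j = (\<Sum>k\<in>UNIV. G $ i $ k * ?M z $ k $ j) + P $ i $ j" for z i j
    by (simp add: matrix_matrix_mult_def)
  have "\<not> (\<exists>B. B ** ?M z0 = mat 1)"
    using J0[OF z0(1)] by (simp add: invertible_det_nz flip: invertible_left_inverse)
  then obtain x where x: "x \<noteq> 0" "?M z0 *v x = 0"
    unfolding matrix_left_invertible_ker by blast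
  let ?F = "{z \<in> D. \<phi> z = \<phi> z0}"
  have F: "compact ?F"
  proof -
    have "\<phi> z0 \<in> D'" using \<phi> z0(1) by auto
    then have "compact {z \<in> D. \<phi> z \<in> {\<phi> z0}}"
      by (intro proper_map_iff_compact_preimage[OF holomorphic_map_on_imp_continuous_on[OF h] \<phi>, 
          THEN iffD1, OF pm, rule_format]) simp
    then show ?thesis by simp
  qed
  let ?h = "\<lambda>z. cmod (\<gamma> z) * exp ((norm z)\<^sup>2 / 2)"
  have "continuous_on D \<gamma>"
    unfolding \<gamma>_def
    by (intro continuous_on_det_matrix, unfold entry) (intro continuous_intros continuous_on_jacobian_component[OF h D(1)])
  then have "continuous_on ?F ?h"
    by (intro continuous_intros) (auto intro: continuous_on_subset)
  then obtain a where a: "a \<in> ?F" "\<And>z. z \<in> ?F \<Longrightarrow> ?h z \<le> ?h a"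
    using continuous_attains_sup[OF F, of ?h] z0(1) by blast
  have "0 < ?h z0" by (simp add: \<gamma>0)
  also have "?h z0 \<le> ?h a" using a(2) z0(1) by simp
  finally have \<gamma>a: "\<gamma> a \<noteq> 0" by auto
  have aD: "a \<in> D" using a(1) by simp
  obtain r c c' where r: "r > 0" "c 0 = a" and cD: "\<And>t. t \<in> ball 0 r \<Longrightarrow> c t \<in> D \<and> \<phi> (c t) = \<phi> a"
    and dc: "\<And>t. t \<in> ball 0 r \<Longrightarrow> (c has_derivative (\<lambda>h. h *s c' t)) (at t)"
    and inj: "\<And>t. t \<in> ball 0 r \<Longrightarrow> c t = a \<Longrightarrow> t *s x = 0"
    using holomorphic_disc_in_fibre[OF h D(1) z0(2) G P_def aD \<gamma>a[unfolded \<gamma>_def] x(2)] by blast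
  define L where "L = (\<lambda>z :: complex^'n. \<Sum>i\<in>UNIV. z $ i * cnj (a $ i))"
  \<comment> \<open>By \<open>2 Re \<langle>z, a\<rangle> = \<bar>z\<bar>\<^sup>2 + \<bar>a\<bar>\<^sup>2 - \<bar>z - a\<bar>\<^sup>2\<close>, the modulus of the holomorphic function \<open>q\<close> is a
    constant times \<open>h (c t) * exp (- \<bar>c t - a\<bar>\<^sup>2 / 2)\<close>. As \<open>h\<close> is maximal at \<open>a\<close> on the fibre, this is
    largest for \<open>c t = a\<close> only.\<close>
  define q where "q = (\<lambda>t. \<gamma> (c t) * exp (L (c t)))"
  have qn: "cmod (q t) = ?h (c t) * (exp ((norm a)\<^sup>2 / 2) * exp (- ((norm (c t - a))\<^sup>2 / 2)))" for t
  proof -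
    have "c t \<bullet> a = (norm (c t))\<^sup>2 / 2 + ((norm a)\<^sup>2 / 2 + - ((norm (c t - a))\<^sup>2 / 2))"
      by (simp add: power2_norm_eq_inner inner_diff_left inner_diff_right inner_commute field_simps)
    moreover have "Re (L (c t)) = c t \<bullet> a" unfolding L_def by (rule inner_complex_vec[symmetric])
    ultimately show ?thesis
      by (simp add: q_def norm_mult mult.assoc flip: exp_add)
  qed
  have le: "?h (c t) \<le> ?h a" if "t \<in> ball 0 r" for t using cD[OF that] a by auto
  have comp: "(\<lambda>t. c t $ i) holomorphic_on ball 0 r" for i
    unfolding holomorphic_on_open[OF open_ball]
  proof
    fix t :: complex assume "t \<in> ball 0 r"
    from bounded_linear.has_derivative[OF bounded_linear_vec_nth dc[OF this], of i]
    show "\<exists>f'. ((\<lambda>t. c t $ i) has_field_derivative f') (at t)"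
      by (intro exI[of _ "c' t $ i"]) (simp add: has_field_derivative_def mult_commute_abs)
  qed
  have "(\<lambda>t. ?M (c t) $ i $ j) holomorphic_on ball 0 r" for i j
  proof -
    have "(\<lambda>t. frechet_derivative (\<lambda>z. \<phi> z $ i) (at (c t)) (axis j 1)) holomorphic_on ball 0 r"
      using h cD by (intro holomorphic_on_frechet_derivative_along_curve[OF _ D(1) open_ball _ dc])
         (auto simp: holomorphic_map_on_def)
    then show ?thesis
      by (rule holomorphic_transform) (use jacobian_component[OF h] cD in auto)
  qed
  then have "q holomorphic_on ball 0 r"
    unfolding q_def \<gamma>_def L_def
    by (intro holomorphic_intros holomorphic_on_det comp, unfold entry) (intro holomorphic_intros)
  then have "q constant_on ball 0 r"
  proof (rule maximum_modulus_principle[where U = "ball 0 r" and \<xi> = 0])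
    fix t :: complex assume t: "t \<in> ball 0 r"
    have "cmod (q t) \<le> ?h (c t) * (exp ((norm a)\<^sup>2 / 2) * 1)"
      unfolding qn by (intro mult_left_mono) auto
    also have "\<dots> \<le> ?h a * (exp ((norm a)\<^sup>2 / 2) * 1)"
      using le[OF t] by (intro mult_right_mono) auto
    also have "\<dots> = cmod (q 0)" unfolding qn r(2) by simp
    finally show "cmod (q t) \<le> cmod (q 0)" .
  qed (use r in auto)
  define t where "t = complex_of_real (r / 2)"
  have t: "t \<in> ball 0 r" "t \<noteq> 0" using r by (auto simp: t_def)
  have "q t = q 0" using \<open>q constant_on ball 0 r\<close> t r(1) by (metis constant_on_def centre_in_ball)
  then have eq: "?h (c t) * (exp ((norm a)\<^sup>2 / 2) * exp (- ((norm (c t - a))\<^sup>2 / 2))) = ?h a * exp ((norm a)\<^sup>2 / 2)"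
    using qn[of t] qn[of 0] r(2) by simp
  have "c t = a"
  proof (rule ccontr)
    assume ne: "c t \<noteq> a"
    have "?h (c t) * (exp ((norm a)\<^sup>2 / 2) * exp (- ((norm (c t - a))\<^sup>2 / 2))) 
        \<le> ?h a * (exp ((norm a)\<^sup>2 / 2) * exp (- ((norm (c t - a))\<^sup>2 / 2)))"
      using le[OF t(1)] by (intro mult_right_mono) auto
    also have "\<dots> < ?h a * (exp ((norm a)\<^sup>2 / 2) * 1)"
      using ne \<gamma>a by (intro mult_strict_left_mono) auto
    finally show False using eq by simp
  qed
  then have "t *s x = 0" by (rule inj[OF t(1)])
  then show False using t x by simp
qed

section \<open>Change of variables for maps of finite multiplicity\<close>

lemma compact_cover_by_injective_pieces:
  fixes \<phi> :: "complex^'n \<Rightarrow> complex^'n"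
  assumes h: "holomorphic_map_on \<phi> D" "open D"
  obtains K :: "nat \<Rightarrow> (complex^'n) set" where "\<And>n. compact (K n)" "\<And>n. inj_on \<phi> (K n)"
    "(\<Union>n. K n) = {z \<in> D. complex_jacobian \<phi> z \<noteq> 0}"
proof -
  let ?R = "{z \<in> D. complex_jacobian \<phi> z \<noteq> 0}"
  have "open ?R"
    using continuous_open_preimage[OF continuous_on_complex_jacobian[OF h] h(2), of "- {0}"]
    by (simp add: Int_def vimage_def open_Compl)
  let ?B = "{ball z r | z r. cball z r \<subseteq> ?R \<and> inj_on \<phi> (cball z r)}"
  have un: "\<Union>?B = ?R"
  proof (intro equalityI subsetI)
    fix z assume "z \<in> \<Union>?B"
    then obtain y r where "z \<in> ball y r" "cball y r \<subseteq> ?R" by blast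
    then show "z \<in> ?R" using ball_subset_cball by blast
  next
    fix z assume z: "z \<in> ?R"
    then have zD: "z \<in> D" "complex_jacobian \<phi> z \<noteq> 0" by auto
    obtain U V g where U: "open U" "z \<in> U" "homeomorphism U V \<phi> g"
      by (rule holomorphic_local_inverse[OF h zD])
    have "open (U \<inter> ?R)" using U(1) \<open>open ?R\<close> by (rule open_Int)
    moreover have "z \<in> U \<inter> ?R" using U(2) z by simp
    ultimately have "\<exists>r>0. cball z r \<subseteq> U \<inter> ?R" unfolding open_contains_cball by (rule bspec)
    then obtain r where r: "r > 0" "cball z r \<subseteq> U \<inter> ?R" by blast
    moreover have "inj_on \<phi> U"
      using homeomorphism_apply1[OF U(3)] by (rule inj_on_inverseI)
    ultimately have "ball z r \<in> ?B" by (auto intro: inj_on_subset)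
    then show "z \<in> \<Union>?B" using r(1) by (intro UnionI[of "ball z r"]) auto
  qed
  obtain \<B> where \<B>: "\<B> \<subseteq> ?B" "countable \<B>" "\<Union>\<B> = \<Union>?B"
    by (rule Lindelof[of ?B]) auto
  \<comment> \<open>The empty set keeps the family nonempty when \<open>\<phi>\<close> is everywhere degenerate.\<close>
  let ?K = "closure ` \<B> \<union> {{}}"
  have K: "compact k \<and> inj_on \<phi> k \<and> k \<subseteq> ?R" if "k \<in> ?K" for k
  proof -
    from that consider "k = {}" | B where "B \<in> \<B>" "k = closure B" by auto
    then show ?thesis
    proof cases
      case 2
      then obtain z r where B: "B = ball z r" "cball z r \<subseteq> ?R" "inj_on \<phi> (cball z r)" using \<B>(1) by blast
      have "k \<subseteq> cball z r" unfolding 2(2) B(1) by (rule closure_minimal) auto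
      then show ?thesis using B unfolding 2(2) by (auto intro: inj_on_subset)
    qed auto
  qed
  have cK: "countable ?K" "?K \<noteq> {}" using \<B>(2) by auto
  show ?thesis
  proof (rule that[of "from_nat_into ?K"])
    show "compact (from_nat_into ?K n)" "inj_on \<phi> (from_nat_into ?K n)" for n
      using K[OF from_nat_into[OF cK(2)]] by auto
    have "(\<Union>n. from_nat_into ?K n) = \<Union>?K"
      by (simp only: range_from_nat_into[OF cK(2,1)])
    also have "\<dots> = ?R"
    proof
      show "\<Union>?K \<subseteq> ?R" by (rule Union_least) (use K in simp)
      show "?R \<subseteq> \<Union>?K"
      proof
        fix z assume "z \<in> ?R"
        then have "z \<in> \<Union>\<B>" unfolding \<B>(3) un .
        then obtain B where "B \<in> \<B>" "z \<in> B" by (rule UnionE)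
        then have "closure B \<in> ?K" "z \<in> closure B" using closure_subset[of B] by auto
        then show "z \<in> \<Union>?K" by (rule UnionI)
      qed
    qed
    finally show "(\<Union>n. from_nat_into ?K n) = ?R" .
  qed
qed

lemma vimage_Int_in_borel:
  assumes "continuous_on D f" "D \<in> sets borel" "E \<in> sets borel"
  shows "D \<inter> f -` E \<in> sets borel"
proof -
  have "f \<in> borel_measurable (restrict_space borel D)"
    using assms(1) by (rule borel_measurable_continuous_on_restrict)
  then have "f -` E \<inter> space (restrict_space borel D) \<in> sets (restrict_space borel D)"
    using assms(3) by (rule measurable_sets)
  then show ?thesis
    using assms(2) by (simp add: space_restrict_space sets_restrict_space_iff Int_commute)
qed

text \<open>Cut the complement of the critical points into disjoint Borel pieces on which \<open>\<phi>\<close> is injective, and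
  add the volumes of their images; almost every point of \<open>E\<close> is covered \<open>m\<close> times. Critical points
  contribute nothing on the left because the weight vanishes there.\<close>

proposition nn_integral_jacobian_eq_multiplicity:
  fixes \<phi> :: "complex^'n \<Rightarrow> complex^'n"
  assumes h: "holomorphic_map_on \<phi> D" "open D" and m: "has_multiplicity D D' \<phi> m"
    and E: "E \<in> sets borel" "E \<subseteq> D'"
  shows "(\<integral>\<^sup>+z. ennreal ((cmod (complex_jacobian \<phi> z))\<^sup>2) * indicator (D \<inter> \<phi> -` E) z \<partial>lborel)
         = of_nat m * emeasure lborel E"
proof -
  let ?w = "\<lambda>z. ennreal ((cmod (complex_jacobian \<phi> z))\<^sup>2)"
  let ?R = "{z \<in> D. complex_jacobian \<phi> z \<noteq> 0}"
  obtain K :: "nat \<Rightarrow> (complex^'n) set" where K: "\<And>n. compact (K n)" "\<And>n. inj_on \<phi> (K n)" "(\<Union>n. K n) = ?R"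
    using compact_cover_by_injective_pieces[OF h] by blast
  have KD: "K n \<subseteq> D" for n using K(3) by blast
  have PE: "D \<inter> \<phi> -` E \<in> sets borel"
    using h by (intro vimage_Int_in_borel holomorphic_map_on_imp_continuous_on E) auto
  define A where "A = (\<lambda>n. disjointed K n \<inter> (D \<inter> \<phi> -` E))"
  have "range (disjointed K) \<subseteq> sets borel"
    using K(1) by (intro sets.range_disjointed_sets) (auto intro: borel_closed compact_imp_closed)
  then have Ab: "A n \<in> sets borel" for n using PE by (auto simp: A_def)
  have AK: "A n \<subseteq> K n" for n using disjointed_subset[of K n] by (auto simp: A_def)
  have dA: "disjoint_family A"
    using disjoint_family_disjointed[of K] unfolding disjoint_family_on_def A_def by blast
  have UA: "(\<Union>n. A n) = ?R \<inter> \<phi> -` E"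
    using UN_disjointed_eq[of K] K(3) by (auto simp: A_def)
  note im = emeasure_holomorphic_image[OF h K(1) KD K(2) AK Ab]
  \<comment> \<open>A noncritical value has its \<open>m\<close> preimages in distinct points of the disjoint pieces, and each
    piece contributes at most one of them.\<close>
  have count: "(\<Sum>n. indicator (\<phi> ` A n) w) = of_nat m * (indicator E w :: ennreal)"
    if w: "w \<notin> critical_values \<phi> D" for w
  proof (cases "w \<in> E")
    case False
    then have "indicator (\<phi> ` A n) w = (0::ennreal)" for n by (auto simp: A_def indicator_def)
    then show ?thesis using False by simp
  next
    case True
    let ?Z = "{z \<in> D. \<phi> z = w}"
    have Z: "finite ?Z" "card ?Z = m" using m w True E(2) by (auto simp: has_multiplicity_def)
    have ZA: "z \<in> (\<Union>n. A n)" if "z \<in> ?Z" for z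
      using that w True unfolding UA critical_values_def by auto
    have "indicator (\<phi> ` A n) w = (\<Sum>z\<in>?Z. indicator (A n) z :: ennreal)" for n
    proof (cases "w \<in> \<phi> ` A n")
      case True
      then obtain z where z: "z \<in> A n" "w = \<phi> z" by blast
      have "y = z" if "y \<in> A n" "\<phi> y = w" for y
        using inj_onD[OF K(2)[of n], of y z] that z AK[of n] by auto
      moreover have "z \<in> D" using z(1) by (simp add: A_def)
      ultimately have "?Z \<inter> A n = {z}" using z by auto
      then show ?thesis using True Z(1) z(1) 
        by (simp add: sum.inter_restrict[OF Z(1), symmetric] indicator_def)
    next
      case False
      then have "indicator (A n) z = (0::ennreal)" if "z \<in> ?Z" for z using that by (auto simp: indicator_def)
      then show ?thesis using False by simp
    qed
    then have "(\<Sum>n. indicator (\<phi> ` A n) w) = (\<Sum>n. \<Sum>z\<in>?Z. indicator (A n) z :: ennreal)" by simp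
    also have "\<dots> = (\<Sum>z\<in>?Z. \<Sum>n. indicator (A n) z)"
      by (rule suminf_sum) auto
    also have "\<dots> = (\<Sum>z\<in>?Z. 1)"
      using ZA by (intro sum.cong refl) (simp add: suminf_indicator[OF dA])
    also have "\<dots> = of_nat m" using Z(2) by simp
    finally show ?thesis using True by simp
  qed
  have wA: "(\<lambda>z. ?w z * indicator (A n) z) \<in> borel_measurable borel" for n
    using AK[of n] KD[of n] by (intro borel_measurable_jacobian_weight[OF h Ab]) auto
  have "(\<integral>\<^sup>+z. ?w z * indicator (D \<inter> \<phi> -` E) z \<partial>lborel) = (\<integral>\<^sup>+z. (\<Sum>n. ?w z * indicator (A n) z) \<partial>lborel)"
  proof (rule nn_integral_cong)
    fix z
    have "(\<Sum>n. ?w z * indicator (A n) z) = ?w z * indicator (?R \<inter> \<phi> -` E) z"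
      by (simp add: ennreal_suminf_cmult suminf_indicator[OF dA] UA)
    also have "\<dots> = ?w z * indicator (D \<inter> \<phi> -` E) z" by (auto simp: indicator_def)
    finally show "?w z * indicator (D \<inter> \<phi> -` E) z = (\<Sum>n. ?w z * indicator (A n) z)" ..
  qed
  also have "\<dots> = (\<Sum>n. \<integral>\<^sup>+z. ?w z * indicator (A n) z \<partial>lborel)"
    using wA by (intro nn_integral_suminf) simp
  also have "\<dots> = (\<Sum>n. emeasure lborel (\<phi> ` A n))" using im(2) by simp
  also have "\<dots> = (\<Sum>n. \<integral>\<^sup>+w. indicator (\<phi> ` A n) w \<partial>lborel)" using im(1) by simp
  also have "\<dots> = (\<integral>\<^sup>+w. (\<Sum>n. indicator (\<phi> ` A n) w) \<partial>lborel)"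
    using im(1) by (intro nn_integral_suminf[symmetric]) simp
  also have "\<dots> = (\<integral>\<^sup>+w. of_nat m * indicator E w \<partial>lborel)"
    using AE_not_critical_value[OF h(1)] by (intro nn_integral_cong_AE) (auto elim!: eventually_mono simp: count)
  also have "\<dots> = of_nat m * emeasure lborel E" using E(1) by (simp add: nn_integral_cmult)
  finally show ?thesis .
qed

text \<open>The Borel version of \<open>lebesgue_on D\<close>. Preimages of null sets under \<open>\<phi>\<close> need not be Lebesgue measurable a
  priori, so image measures are taken with Borel sets.\<close>

abbreviation borel_on :: "(complex^'n) set \<Rightarrow> (complex^'n) measure" where
  "borel_on D \<equiv> restrict_space lborel D"

text \<open>In terms of measures: \<open>\<phi>\<close> maps the measure with density \<open>\<bar>J\<bar>\<^sup>2\<close> to \<open>m\<close> times Lebesgue measure on \<open>D'\<close>.\<close>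

proposition change_of_variables_multiplicity:
  fixes \<phi> :: "complex^'n \<Rightarrow> complex^'n" and f :: "complex^'n \<Rightarrow> complex"
  assumes h: "holomorphic_map_on \<phi> D" "open D" "\<phi> \<in> D \<rightarrow> D'" "open D'" and m: "has_multiplicity D D' \<phi> m"
    and f: "integrable (borel_on D') f"
  shows "integrable (borel_on D) (\<lambda>z. (cmod (complex_jacobian \<phi> z))\<^sup>2 *\<^sub>R f (\<phi> z))"
    and "(\<integral>z. (cmod (complex_jacobian \<phi> z))\<^sup>2 *\<^sub>R f (\<phi> z) \<partial>borel_on D) = of_nat m * (\<integral>w. f w \<partial>borel_on D')"
proof -
  let ?w = "\<lambda>z. (cmod (complex_jacobian \<phi> z))\<^sup>2"
  have \<phi>m: "\<phi> \<in> borel_on D \<rightarrow>\<^sub>M borel_on D'"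
  proof (rule measurable_restrict_space2)
    show "\<phi> \<in> space (borel_on D) \<rightarrow> D'" using h(3) by (auto simp: space_restrict_space)
    show "\<phi> \<in> borel_on D \<rightarrow>\<^sub>M lborel"
      using borel_measurable_continuous_on_restrict[OF holomorphic_map_on_imp_continuous_on[OF h(1)]]
      by (simp cong: measurable_cong_sets add: sets_restrict_space)
  qed
  have wm: "?w \<in> borel_measurable (borel_on D)"
  proof -
    have "continuous_on D ?w"
      by (intro continuous_intros continuous_on_complex_jacobian[OF h(1,2)])
    from borel_measurable_continuous_on_restrict[OF this] show ?thesis
      by (simp cong: measurable_cong_sets add: sets_restrict_space)
  qed
  have eq: "distr (density (borel_on D) ?w) (borel_on D') \<phi> = density (borel_on D') (\<lambda>_. ennreal (real m))"
  proof (rule measure_eqI)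
    fix E assume "E \<in> sets (distr (density (borel_on D) ?w) (borel_on D') \<phi>)"
    then have E': "E \<in> sets (borel_on D')" by simp
    then have E: "E \<in> sets borel" "E \<subseteq> D'" using h(4) by (auto simp: sets_restrict_space_iff)
    have "emeasure (distr (density (borel_on D) ?w) (borel_on D') \<phi>) E 
       = (\<integral>\<^sup>+z. ennreal (?w z) * indicator (\<phi> -` E \<inter> D) z \<partial>borel_on D)"
      using E' \<phi>m wm measurable_sets[OF \<phi>m E']
      by (simp add: emeasure_distr emeasure_density space_restrict_space)
    also have "\<dots> = (\<integral>\<^sup>+z. ennreal (?w z) * indicator (\<phi> -` E \<inter> D) z * indicator D z \<partial>lborel)"
      using h(2) by (intro nn_integral_restrict_space) auto
    also have "\<dots> = (\<integral>\<^sup>+z. ennreal (?w z) * indicator (D \<inter> \<phi> -` E) z \<partial>lborel)"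
      by (intro nn_integral_cong) (auto simp: indicator_def)
    also have "\<dots> = of_nat m * emeasure lborel E"
      by (rule nn_integral_jacobian_eq_multiplicity[OF h(1,2) m E])
    also have "\<dots> = emeasure (density (borel_on D') (\<lambda>_. ennreal (real m))) E"
      using E E' h(4) by (simp add: emeasure_density nn_integral_cmult emeasure_restrict_space ennreal_of_nat_eq_real_of_nat)
    finally show "emeasure (distr (density (borel_on D) ?w) (borel_on D') \<phi>) E =
       emeasure (density (borel_on D') (\<lambda>_. ennreal (real m))) E" .
  qed simp
  have fm: "f \<in> borel_measurable (borel_on D')" using f by simp
  have f\<phi>: "(\<lambda>z. f (\<phi> z)) \<in> borel_measurable (borel_on D)" using \<phi>m fm by (rule measurable_compose)
  have \<phi>m': "\<phi> \<in> density (borel_on D) ?w \<rightarrow>\<^sub>M borel_on D'" using \<phi>m by simp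
  have "integrable (density (borel_on D') (\<lambda>_. ennreal (real m))) f"
    using f by (subst integrable_density) auto
  then have "integrable (density (borel_on D) ?w) (\<lambda>z. f (\<phi> z))"
    unfolding eq[symmetric] by (subst (asm) integrable_distr_eq[OF \<phi>m' fm])
  then show "integrable (borel_on D) (\<lambda>z. ?w z *\<^sub>R f (\<phi> z))"
    by (subst (asm) integrable_density[OF f\<phi> wm]) auto
  have "(\<integral>z. ?w z *\<^sub>R f (\<phi> z) \<partial>borel_on D) = (\<integral>z. f (\<phi> z) \<partial>density (borel_on D) ?w)"
    by (rule integral_density[OF f\<phi> wm, symmetric]) simp
  also have "\<dots> = (\<integral>w. f w \<partial>density (borel_on D') (\<lambda>_. ennreal (real m)))"
    unfolding eq[symmetric] by (rule integral_distr[OF \<phi>m' fm, symmetric])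
  also have "\<dots> = (\<integral>w. real m *\<^sub>R f w \<partial>borel_on D')"
    using fm by (intro integral_density) auto
  also have "\<dots> = of_nat m * (\<integral>w. f w \<partial>borel_on D')" by (simp add: scaleR_conv_of_real)
  finally show "(\<integral>z. ?w z *\<^sub>R f (\<phi> z) \<partial>borel_on D) = of_nat m * (\<integral>w. f w \<partial>borel_on D')" .
qed

text \<open>A rotation is a holomorphic automorphism of multiplicity one with Jacobian of modulus one.\<close>

lemma integral_rotation:
  fixes f :: "complex^'n \<Rightarrow> complex"
  assumes D: "open D" "circular D" and f: "integrable (borel_on D) f"
  shows "integrable (borel_on D) (\<lambda>z. f (cis \<theta> *s z))" (is ?A)
    and "(\<integral>z. f (cis \<theta> *s z) \<partial>borel_on D) = (\<integral>z. f z \<partial>borel_on D)" (is ?B)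
proof -
  define A where "A = (\<chi> i j. if i = j then cis \<theta> else 0 :: complex^'n^'n)"
  have Av: "A *v z = cis \<theta> *s z" for z
    by (simp add: A_def vec_eq_iff matrix_vector_mult_def if_distrib[of "\<lambda>y. y * _"] cong: if_cong)
  have der: "((\<lambda>z. cis \<theta> *s z) has_derivative (*v) A) (at z)" for z :: "complex^'n"
  proof -
    have "(*v) A = (\<lambda>z. cis \<theta> *s z)" using Av by auto
    then show ?thesis using bounded_linear_imp_has_derivative[OF bounded_linear_smult_right] by metis
  qed
  have J: "jacobian (\<lambda>z. cis \<theta> *s z) (at z) = A" for z :: "complex^'n"
    by (simp only: jacobian_def frechet_derivative_at[OF der, symmetric] matrix_of_matrix_vector_mul)
  have "rdet A = 1" by (rule rdet_norm_preserving) (simp add: Av norm_smult_complex)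
  then have w: "(cmod (complex_jacobian (\<lambda>z. cis \<theta> *s z) z))\<^sup>2 = 1" for z :: "complex^'n"
    unfolding complex_jacobian_def J using abs_det_real_matrix[of A] by (simp add: rdet_def)
  have "holomorphic_map_on (\<lambda>z :: complex^'n. cis \<theta> *s z) D"
    unfolding holomorphic_map_on_def holomorphic_fun_on_def
  proof (intro allI ballI exI conjI)
    fix i and z :: "complex^'n"
    show "((\<lambda>z. (cis \<theta> *s z) $ i) has_derivative (\<lambda>v. (A *v v) $ i)) (at z)"
      by (rule bounded_linear.has_derivative[OF bounded_linear_vec_nth der])
  qed (simp add: Av)
  moreover have "(\<lambda>z. cis \<theta> *s z) \<in> D \<rightarrow> D" using circular_cis[OF D(2)] by blast
  moreover have "has_multiplicity D D (\<lambda>z. cis \<theta> *s z) 1"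
  proof -
    have "{z \<in> D. cis \<theta> *s z = w} = {cis (- \<theta>) *s w}" if "w \<in> D" for w
    proof
      show "{z \<in> D. cis \<theta> *s z = w} \<subseteq> {cis (- \<theta>) *s w}" by (auto simp: vector_smult_assoc cis_mult)
      show "{cis (- \<theta>) *s w} \<subseteq> {z \<in> D. cis \<theta> *s z = w}"
        using circular_cis[OF D(2) that] by (auto simp: vector_smult_assoc cis_mult)
    qed
    then show ?thesis by (simp add: has_multiplicity_def)
  qed
  ultimately show ?A ?B
    using change_of_variables_multiplicity[of "\<lambda>z. cis \<theta> *s z" D D 1 f] D(1) f by (simp_all add: w)
qed

section \<open>Integrals against a rotation invariant weight\<close>

text \<open>Integrate \<open>W z * G (e\<^sup>i\<^sup>\<theta> z)\<close> over \<open>z\<close> and \<open>\<theta>\<close> in both orders. For fixed \<open>\<theta>\<close> the inner integral is the left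
  side, by rotation invariance; for fixed \<open>z\<close> it is \<open>2 \<pi> * W z * G 0\<close>, by \<open>circle_integral_eq\<close>.\<close>

proposition integral_circular_weight:
  fixes G :: "complex^'n \<Rightarrow> complex" and W :: "complex^'n \<Rightarrow> real"
  assumes D: "open D" "connected D" "circular D" "0 \<in> D"
    and G: "holomorphic_fun_on G D" and W: "continuous_on D W" "\<And>z \<theta>. z \<in> D \<Longrightarrow> W (cis \<theta> *s z) = W z"
    and int: "integrable (borel_on D) (\<lambda>z. W z *\<^sub>R G z)"
  shows "(\<integral>z. W z *\<^sub>R G z \<partial>borel_on D) = of_real (\<integral>z. W z \<partial>borel_on D) * G 0"
proof -
  have Db: "D \<inter> space lborel \<in> sets lborel" using D(1) by simp
  let ?f = "\<lambda>z. W z *\<^sub>R G z"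
  let ?I = "\<integral>z. ?f z \<partial>borel_on D"
  define H where "H = (\<lambda>(\<theta>, z). indicator ({0..2*pi} \<times> D) (\<theta>, z) *\<^sub>R (W z *\<^sub>R G (cis \<theta> *s z)))"
  have H: "H (\<theta>, z) = indicator {0..2*pi} \<theta> *\<^sub>R (indicator D z *\<^sub>R ?f (cis \<theta> *s z))" for \<theta> z
    using W(2) by (auto simp: H_def indicator_def)
  have rot: "integrable (borel_on D) (\<lambda>z. ?f (cis \<theta> *s z))" "(\<integral>z. ?f (cis \<theta> *s z) \<partial>borel_on D) = ?I" for \<theta>
    using integral_rotation[OF D(1,3) int] by auto
  have rotn: "(\<integral>z. cmod (?f (cis \<theta> *s z)) \<partial>borel_on D) = (\<integral>z. cmod (?f z) \<partial>borel_on D)" for \<theta>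
  proof -
    have "integrable (borel_on D) (\<lambda>z. complex_of_real (cmod (?f z)))"
      using int by (intro integrable_of_real integrable_norm)
    from integral_rotation(2)[OF D(1,3) this, of \<theta>] show ?thesis
      by (simp only: integral_complex_of_real of_real_eq_iff)
  qed
  have Hm: "H \<in> borel_measurable (lborel \<Otimes>\<^sub>M lborel)"
  proof -
    have "continuous_on ({0..2*pi} \<times> D) (\<lambda>x. W (snd x) *\<^sub>R G (cis (fst x) *s snd x))"
      by (intro continuous_intros continuous_on_rotation[OF holomorphic_fun_on_imp_continuous_on[OF G] D(3)]
           continuous_on_compose2[OF W(1)]) auto
    moreover have "{0..2*pi} \<times> D \<in> sets borel"
      using D(1) by (intro borel_Times) auto
    ultimately have "(\<lambda>x. indicator ({0..2*pi} \<times> D) x *\<^sub>R (W (snd x) *\<^sub>R G (cis (fst x) *s snd x))) \<in> borel_measurable borel"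
      by (rule borel_measurable_continuous_on_indicator[rotated])
    then show ?thesis by (simp add: H_def lborel_prod case_prod_unfold)
  qed
  have Hz: "(\<integral>z. H (\<theta>, z) \<partial>lborel) = indicator {0..2*pi} \<theta> *\<^sub>R ?I" for \<theta>
    by (simp only: H integral_scaleR_right integral_restrict_space[OF Db, symmetric] rot(2))
  \<comment> \<open>Fubini applies because the integral of \<open>\<bar>H\<bar>\<close> over \<open>z\<close> does not depend on the angle.\<close>
  have iH: "integrable (lborel \<Otimes>\<^sub>M lborel) H"
  proof (rule lborel_pair.Fubini_integrable[OF Hm])
    have "(\<integral>z. norm (H (\<theta>, z)) \<partial>lborel) = indicator {0..2*pi} \<theta> *\<^sub>R (\<integral>z. cmod (?f z) \<partial>borel_on D)" for \<theta>
    proof -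
      have nH: "norm (H (\<theta>, z)) = indicator {0..2*pi} \<theta> *\<^sub>R (indicator D z *\<^sub>R cmod (?f (cis \<theta> *s z)))" for z
        unfolding H by (simp add: indicator_def)
      show ?thesis
        by (simp only: nH integral_scaleR_right integral_restrict_space[OF Db, symmetric] rotn)
    qed
    moreover have "integrable lborel (\<lambda>\<theta>. indicator {0..2*pi} \<theta> *\<^sub>R (\<integral>z. cmod (?f z) \<partial>borel_on D))"
      by (intro integrable_scaleR_left integrable_real_indicator) auto
    ultimately show "integrable lborel (\<lambda>\<theta>. \<integral>z. norm (H (\<theta>, z)) \<partial>lborel)" by simp
    show "AE \<theta> in lborel. integrable lborel (\<lambda>z. H (\<theta>, z))"
      unfolding H using rot(1) by (intro AE_I2 integrable_scaleR_right) (simp add: integrable_restrict_space[OF Db])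
  qed
  have inner: "(\<integral>\<theta>. H (\<theta>, z) \<partial>lborel) = indicator D z *\<^sub>R (W z *\<^sub>R (2 * pi * G 0))" for z
  proof (cases "z \<in> D")
    case True
    have "continuous_on {0..2*pi} (\<lambda>\<theta>. G (cis \<theta> *s z))"
      using True by (intro continuous_on_rotation[OF holomorphic_fun_on_imp_continuous_on[OF G] D(3)] continuous_intros) auto
    then have "set_integrable lborel {0..2*pi} (\<lambda>\<theta>. G (cis \<theta> *s z))"
      by (rule borel_integrable_atLeastAtMost')
    from set_borel_integral_eq_integral(2)[OF this]
    have "(\<integral>\<theta>. indicator {0..2*pi} \<theta> *\<^sub>R G (cis \<theta> *s z) \<partial>lborel) = 2 * pi * G 0"
      using circle_integral_eq[OF G D True] by (simp add: set_lebesgue_integral_def circle_integral_def)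
    moreover have Hw: "H (\<theta>, z) = W z *\<^sub>R (indicator {0..2*pi} \<theta> *\<^sub>R G (cis \<theta> *s z))" for \<theta>
      using True by (simp add: H_def indicator_def)
    ultimately have "(\<integral>\<theta>. H (\<theta>, z) \<partial>lborel) = W z *\<^sub>R (2 * pi * G 0)"
      by (simp only: Hw integral_scaleR_right)
    then show ?thesis using True by simp
  next
    case False
    then show ?thesis by (simp add: H_def)
  qed
  have "(\<integral>z. (\<integral>\<theta>. H (\<theta>, z) \<partial>lborel) \<partial>lborel) = (\<integral>\<theta>. (\<integral>z. H (\<theta>, z) \<partial>lborel) \<partial>lborel)"
    using lborel_pair.Fubini_integral[of "\<lambda>\<theta> z. H (\<theta>, z)"] iH by simp
  then have "(\<integral>z. indicator D z *\<^sub>R (W z *\<^sub>R (2 * pi * G 0)) \<partial>lborel) = (\<integral>\<theta>. indicator {0..2*pi} \<theta> *\<^sub>R ?I \<partial>lborel)"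
    unfolding inner Hz .
  also have "\<dots> = (2 * pi) *\<^sub>R ?I" by simp
  also have "(\<integral>z. indicator D z *\<^sub>R (W z *\<^sub>R (2 * pi * G 0)) \<partial>lborel) = (\<integral>z. W z *\<^sub>R (2 * pi * G 0) \<partial>borel_on D)"
    by (rule integral_restrict_space[OF Db, symmetric])
  also have "\<dots> = (\<integral>z. of_real (W z) * (2 * pi * G 0) \<partial>borel_on D)"
    by (simp add: scaleR_conv_of_real)
  also have "\<dots> = of_real (\<integral>z. W z \<partial>borel_on D) * (2 * pi * G 0)" by simp
  finally show ?thesis by (simp add: scaleR_conv_of_real)
qed

lemma homogeneous_polynomial_smult:
  assumes "homogeneous_polynomial d p" shows "p (a *s z) = a ^ d * p z"
proof -
  obtain c where c: "\<And>z. p z = (\<Sum>\<alpha> | (\<Sum>i\<in>UNIV. \<alpha> i) = d. c \<alpha> * (\<Prod>i\<in>UNIV. (z $ i) ^ \<alpha> i))"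
    using assms unfolding homogeneous_polynomial_def by blast
  have "p (a *s z) = (\<Sum>\<alpha> | (\<Sum>i\<in>UNIV. \<alpha> i) = d. a ^ d * (c \<alpha> * (\<Prod>i\<in>UNIV. (z $ i) ^ \<alpha> i)))"
    unfolding c by (intro sum.cong refl) (auto simp: power_mult_distrib prod.distrib power_sum)
  then show ?thesis unfolding c by (simp add: sum_distrib_left)
qed

section \<open>The Bergman space\<close>

lemma borel_measurable_borel_on:
  assumes "continuous_on D f" shows "f \<in> borel_measurable (borel_on D)"
  using borel_measurable_continuous_on_restrict[OF assms]
  by (simp cong: measurable_cong_sets add: sets_restrict_space)

lemma lebesgue_on_eq_borel_on:
  fixes f :: "complex^'n \<Rightarrow> 'b::{banach, second_countable_topology}"
  assumes D: "open D" and f: "continuous_on D f"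
  shows "integrable (lebesgue_on D) f \<longleftrightarrow> integrable (borel_on D) f"
    and "(\<integral>z. f z \<partial>lebesgue_on D) = (\<integral>z. f z \<partial>borel_on D)"
proof -
  have m: "(\<lambda>z. indicator D z *\<^sub>R f z) \<in> lborel \<rightarrow>\<^sub>M borel"
    using borel_measurable_continuous_on_indicator[OF _ f] D by simp
  have s: "D \<inter> space lborel \<in> sets lborel" "D \<inter> space lebesgue \<in> sets lebesgue" using D by auto
  show "integrable (lebesgue_on D) f \<longleftrightarrow> integrable (borel_on D) f"
    by (simp only: integrable_restrict_space[OF s(1)] integrable_restrict_space[OF s(2)] integrable_completion[OF m])
  show "(\<integral>z. f z \<partial>lebesgue_on D) = (\<integral>z. f z \<partial>borel_on D)"
    by (simp only: integral_restrict_space[OF s(1)] integral_restrict_space[OF s(2)] integral_completion[OF m])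
qed

lemma continuous_AE_zero_imp_zero:
  fixes f :: "complex^'n \<Rightarrow> real"
  assumes D: "open D" and f: "continuous_on D f" and ae: "AE z in borel_on D. f z = 0" and z: "z \<in> D"
  shows "f z = 0"
proof (rule ccontr)
  assume "f z \<noteq> 0"
  let ?U = "{z \<in> D. f z \<noteq> 0}"
  have "open ?U"
    using continuous_open_preimage[OF f D, of "- {0}"] by (simp add: Int_def vimage_def open_Compl)
  moreover have "?U \<noteq> {}" using z \<open>f z \<noteq> 0\<close> by auto
  ultimately have "\<not> negligible ?U" by (rule open_not_negligible)
  have "AE z in lborel. z \<in> D \<longrightarrow> f z = 0"
    using ae D by (subst (asm) AE_restrict_space_iff) auto
  then have "AE z in lborel. z \<notin> ?U" by (auto elim: eventually_mono)
  then have "AE z in lebesgue. z \<notin> ?U" by (rule AE_completion)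
  then have "negligible ?U" 
    using \<open>open ?U\<close> by (simp add: negligible_iff_null_sets AE_iff_null_sets[of ?U lebesgue] )
  then show False using \<open>\<not> negligible ?U\<close> by simp
qed

lemma continuous_integral_zero_imp_zero:
  fixes f :: "complex^'n \<Rightarrow> real"
  assumes D: "open D" and f: "continuous_on D f" "\<And>z. 0 \<le> f z" "integrable (borel_on D) f"
    and 0: "(\<integral>z. f z \<partial>borel_on D) = 0" and z: "z \<in> D"
  shows "f z = 0"
  using continuous_AE_zero_imp_zero[OF D f(1) _ z] integral_nonneg_eq_0_iff_AE[OF f(3)] f(2) 0 by simp

lemma integrable_product_L2:
  fixes a b :: "complex^'n \<Rightarrow> complex"
  assumes "continuous_on D a" "continuous_on D b"
    "integrable (borel_on D) (\<lambda>z. (cmod (a z))\<^sup>2)" "integrable (borel_on D) (\<lambda>z. (cmod (b z))\<^sup>2)"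
  shows "integrable (borel_on D) (\<lambda>z. a z * b z)"
proof (rule Bochner_Integration.integrable_bound)
  show "integrable (borel_on D) (\<lambda>z. (cmod (a z))\<^sup>2 + (cmod (b z))\<^sup>2)" using assms by simp
  show "(\<lambda>z. a z * b z) \<in> borel_measurable (borel_on D)"
    using assms by (intro borel_measurable_borel_on continuous_intros)
  have "x * y \<le> x\<^sup>2 + y\<^sup>2" if "x \<ge> 0" "y \<ge> 0" for x y :: real
    using sum_squares_bound[of x y] that zero_le_mult_iff[of x y] by linarith
  then show "AE z in borel_on D. norm (a z * b z) \<le> norm ((cmod (a z))\<^sup>2 + (cmod (b z))\<^sup>2)"
    by (intro AE_I2) (simp add: norm_mult)
qed

lemma bergman_spaceD:
  assumes D: "open D" and f: "f \<in> bergman_space D"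
  shows "holomorphic_fun_on f D" "continuous_on D f" "integrable (borel_on D) (\<lambda>z. (cmod (f z))\<^sup>2)"
    "z \<notin> D \<Longrightarrow> f z = 0"
proof -
  show h: "holomorphic_fun_on f D" and "z \<notin> D \<Longrightarrow> f z = 0" using f by (auto simp: bergman_space_def)
  show c: "continuous_on D f" using h by (rule holomorphic_fun_on_imp_continuous_on)
  then have "continuous_on D (\<lambda>z. (cmod (f z))\<^sup>2)" by (intro continuous_intros)
  from lebesgue_on_eq_borel_on(1)[OF D this] show "integrable (borel_on D) (\<lambda>z. (cmod (f z))\<^sup>2)"
    using f by (simp add: bergman_space_def square_integrable_on_def)
qed

lemma bergman_spaceI:
  assumes D: "open D" and f: "holomorphic_fun_on f D" "integrable (borel_on D) (\<lambda>z. (cmod (f z))\<^sup>2)"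
    "\<And>z. z \<notin> D \<Longrightarrow> f z = 0"
  shows "f \<in> bergman_space D"
proof -
  have c: "continuous_on D f" using f(1) by (rule holomorphic_fun_on_imp_continuous_on)
  then have "continuous_on D (\<lambda>z. (cmod (f z))\<^sup>2)" by (intro continuous_intros)
  from lebesgue_on_eq_borel_on(1)[OF D this] 
  have "integrable (lebesgue_on D) (\<lambda>z. (cmod (f z))\<^sup>2)" using f(2) by simp
  moreover have "f \<in> borel_measurable (lebesgue_on D)"
    using c D by (intro continuous_imp_measurable_on_sets_lebesgue) auto
  ultimately show ?thesis using f by (simp add: bergman_space_def square_integrable_on_def)
qed

lemma bergman_space_diff_cmult:
  assumes D: "open D" and f: "f \<in> bergman_space D" "g \<in> bergman_space D"
  shows "(\<lambda>z. c * f z - g z) \<in> bergman_space D"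
proof (rule bergman_spaceI[OF D])
  note F = bergman_spaceD[OF D f(1)] and G = bergman_spaceD[OF D f(2)]
  show h: "holomorphic_fun_on (\<lambda>z. c * f z - g z) D"
    by (rule holomorphic_fun_on_diff_cmult[OF F(1) G(1)])
  show "integrable (borel_on D) (\<lambda>z. (cmod (c * f z - g z))\<^sup>2)"
  proof (rule Bochner_Integration.integrable_bound)
    show "integrable (borel_on D) (\<lambda>z. 2 * ((cmod c)\<^sup>2 * (cmod (f z))\<^sup>2) + 2 * (cmod (g z))\<^sup>2)"
      using F(3) G(3) by simp
    show "(\<lambda>z. (cmod (c * f z - g z))\<^sup>2) \<in> borel_measurable (borel_on D)"
      by (intro borel_measurable_borel_on continuous_intros F(2) G(2))
    have "(cmod (a - b))\<^sup>2 \<le> 2 * (cmod a)\<^sup>2 + 2 * (cmod b)\<^sup>2" for a b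
    proof -
      have "(cmod (a - b))\<^sup>2 \<le> (cmod a + cmod b)\<^sup>2" by (intro power_mono norm_triangle_ineq4) simp
      also have "\<dots> \<le> 2 * (cmod a)\<^sup>2 + 2 * (cmod b)\<^sup>2"
        using sum_squares_bound[of "cmod a" "cmod b"] by (simp add: power2_sum)
      finally show ?thesis .
    qed
    from this[of "c * f z" "g z" for z]
    show "AE z in borel_on D. norm ((cmod (c * f z - g z))\<^sup>2) \<le>
        norm (2 * ((cmod c)\<^sup>2 * (cmod (f z))\<^sup>2) + 2 * (cmod (g z))\<^sup>2)"
      by (intro AE_I2) (simp add: norm_mult power_mult_distrib)
  qed
  show "c * f z - g z = 0" if "z \<notin> D" for z using F(4) G(4) that by simp
qed

lemma indicator_in_bergman_space:
  assumes "open D" "bounded D"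
  shows "indicator D \<in> bergman_space D" and "integrable (borel_on D) (\<lambda>_. 1 :: complex)"
proof -
  have fin: "emeasure lborel D < \<infinity>" using assms(2) by (rule emeasure_bounded_finite)
  have Db: "D \<inter> space lborel \<in> sets lborel" using assms(1) by simp
  show int: "integrable (borel_on D) (\<lambda>_. 1 :: complex)"
    using fin assms(1) by (simp add: integrable_restrict_space[OF Db] integrable_indicator_iff)
  show "indicator D \<in> bergman_space D"
  proof (rule bergman_spaceI[OF assms(1)])
    have "((\<lambda>z. indicator D z :: complex) has_derivative (\<lambda>_. 0)) (at z)" if "z \<in> D" for z
      by (rule has_derivative_transform_within_open[OF has_derivative_const[of 1] assms(1) that]) simp
    then show "holomorphic_fun_on (indicator D) D" unfolding holomorphic_fun_on_def
      by (intro ballI exI[of _ "\<lambda>_. 0"]) simp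
    have "integrable (borel_on D) (\<lambda>_. 1 :: real)"
      using integrable_norm[OF int] by simp
    then show "integrable (borel_on D) (\<lambda>z. (cmod (indicator D z))\<^sup>2)"
      by (rule Bochner_Integration.integrable_cong[THEN iffD1, rotated 2]) (auto simp: space_restrict_space)
  qed simp
qed

section \<open>Friedrichs operators and quadrature identities\<close>

text \<open>Conjugating the quadrature identity for \<open>g k\<close> and for \<open>1 * k\<close> shows that \<open>cnj g - cnj (g w0)\<close> is
  orthogonal to every \<open>k\<close> in the Bergman space. So the projection of \<open>cnj g\<close> is a constant on \<open>D\<close>; the
  constant \<open>1\<close> is represented by \<open>indicator D\<close>.\<close>

proposition friedrichs_operator_of_quadrature:
  fixes g :: "complex^'n \<Rightarrow> complex"
  assumes D: "open D" "bounded D" "w0 \<in> D"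
    and quad: "\<And>f g. f \<in> bergman_space D \<Longrightarrow> g \<in> bergman_space D \<Longrightarrow>
      (\<integral>z. f z * g z \<partial>borel_on D) = V * (f w0 * g w0)"
    and g: "g \<in> bergman_space D"
  shows "friedrichs_operator D g = fun_scale (cnj (g w0)) (indicator D)"
proof -
  note A = bergman_spaceD[OF D(1)]
  note u = indicator_in_bergman_space[OF D(1,2)]
  let ?u = "indicator D :: complex^'n \<Rightarrow> complex"
  have int: "integrable (borel_on D) (\<lambda>z. f z * k z)" if f: "f \<in> bergman_space D" and k: "k \<in> bergman_space D" for f k
    using A[OF f] A[OF k] by (intro integrable_product_L2) auto
  show ?thesis
    unfolding friedrichs_operator_def bergman_projection_def
  proof (rule the_equality)
    let ?h = "fun_scale (cnj (g w0)) ?u"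
    \<comment> \<open>A case of closure of the Bergman space under \<open>c * f - g\<close>.\<close>
    have "?h = (\<lambda>z. (cnj (g w0) + 1) * ?u z - ?u z)" by (simp add: fun_scale_def algebra_simps)
    then have hA: "?h \<in> bergman_space D" using bergman_space_diff_cmult[OF D(1) u(1) u(1)] by simp
    have L2: "L2_inner D (\<lambda>z. cnj (g z) - h z) k = 
        cnj (\<integral>z. g z * k z \<partial>borel_on D) - (\<integral>z. h z * cnj (k z) \<partial>borel_on D)"
      if k: "k \<in> bergman_space D" "h \<in> bergman_space D" for h k
    proof -
      have "L2_inner D (\<lambda>z. cnj (g z) - h z) k = (\<integral>z. (cnj (g z) - h z) * cnj (k z) \<partial>borel_on D)"
        unfolding L2_inner_def using A(2)[OF k(1)] A(2)[OF k(2)] A(2)[OF g]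
        by (intro lebesgue_on_eq_borel_on[OF D(1)] continuous_intros)
      also have "\<dots> = (\<integral>z. cnj (g z * k z) - h z * cnj (k z) \<partial>borel_on D)"
        by (simp add: algebra_simps)
      also have "\<dots> = (\<integral>z. cnj (g z * k z) \<partial>borel_on D) - (\<integral>z. h z * cnj (k z) \<partial>borel_on D)"
      proof (rule Bochner_Integration.integral_diff)
        show "integrable (borel_on D) (\<lambda>z. cnj (g z * k z))"
          using int[OF g k(1)] by (simp only: integrable_cnj)
        show "integrable (borel_on D) (\<lambda>z. h z * cnj (k z))"
          using A[OF k(1)] A[OF k(2)] by (intro integrable_product_L2 continuous_intros) auto
      qed
      finally show ?thesis by (simp del: complex_cnj_mult)
    qed
    have hh: "L2_inner D (\<lambda>z. cnj (g z) - ?h z) k = 0" if k: "k \<in> bergman_space D" for k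
    proof -
      have "(\<integral>z. ?h z * cnj (k z) \<partial>borel_on D) = (\<integral>z. cnj (g w0) * cnj (?u z * k z) \<partial>borel_on D)"
        by (intro Bochner_Integration.integral_cong) (auto simp: fun_scale_def indicator_def)
      also have "\<dots> = cnj (g w0) * cnj (\<integral>z. ?u z * k z \<partial>borel_on D)"
        by (simp del: complex_cnj_mult)
      also have "\<dots> = cnj (V * (g w0 * k w0))" using quad[OF u(1) k] D(3) by simp
      finally show ?thesis using L2[OF k hA] quad[OF g k] by simp
    qed
    show "?h \<in> bergman_space D \<and> (\<forall>k\<in>bergman_space D. L2_inner D (\<lambda>z. cnj (g z) - ?h z) k = 0)" using hA hh by blast
    fix h assume h: "h \<in> bergman_space D \<and> (\<forall>k\<in>bergman_space D. L2_inner D (\<lambda>z. cnj (g z) - h z) k = 0)"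
    \<comment> \<open>Two candidates differ by an element of the Bergman space orthogonal to itself.\<close>
    define e where "e = (\<lambda>z. 1 * ?h z - h z)"
    have e: "e \<in> bergman_space D" unfolding e_def using bergman_space_diff_cmult[OF D(1) hA] h by blast
    have ie: "integrable (borel_on D) (\<lambda>z. k z * cnj (e z))" if "k \<in> bergman_space D" for k
      using A[OF that] A[OF e] by (intro integrable_product_L2 continuous_intros) auto
    have "(\<integral>z. ?h z * cnj (e z) \<partial>borel_on D) = (\<integral>z. h z * cnj (e z) \<partial>borel_on D)"
    proof -
      have "h \<in> bergman_space D" "L2_inner D (\<lambda>z. cnj (g z) - h z) e = 0" using h e by auto
      then have "cnj (\<integral>z. g z * e z \<partial>borel_on D) - (\<integral>z. h z * cnj (e z) \<partial>borel_on D) = 0"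
        using L2[OF e, of h] by simp
      moreover have "cnj (\<integral>z. g z * e z \<partial>borel_on D) - (\<integral>z. ?h z * cnj (e z) \<partial>borel_on D) = 0"
        using trans[OF L2[OF e hA, symmetric] hh[OF e]] .
      ultimately show ?thesis by (simp only: right_minus_eq)
    qed
    then have "(\<integral>z. ?h z * cnj (e z) - h z * cnj (e z) \<partial>borel_on D) = 0"
      using ie[OF hA] ie[of h] h by (simp only: Bochner_Integration.integral_diff) simp
    also have "(\<lambda>z. ?h z * cnj (e z) - h z * cnj (e z)) = (\<lambda>z. complex_of_real ((cmod (e z))\<^sup>2))"
      by (rule ext, simp only: complex_norm_square) (simp add: e_def algebra_simps)
    finally have "(\<integral>z. (cmod (e z))\<^sup>2 \<partial>borel_on D) = 0" by (simp del: of_real_power)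
    moreover have "continuous_on D (\<lambda>z. (cmod (e z))\<^sup>2)"
      by (intro continuous_intros A(2)[OF e])
    ultimately have "(cmod (e z))\<^sup>2 = 0" if "z \<in> D" for z
      using continuous_integral_zero_imp_zero[OF D(1) _ _ A(3)[OF e] _ that] by simp
    then have "e z = 0" for z using A(4)[OF e, of z] by (cases "z \<in> D") auto
    then show "h = ?h" by (auto simp: e_def)
  qed
qed

proposition rank_one_of_quadrature:
  fixes D :: "(complex^'n) set"
  assumes D: "open D" "bounded D" "w0 \<in> D"
    and quad: "\<And>f g. f \<in> bergman_space D \<Longrightarrow> g \<in> bergman_space D \<Longrightarrow>
      (\<integral>z. f z * g z \<partial>borel_on D) = V * (f w0 * g w0)"
  shows "rank_one_on (friedrichs_operator D) (bergman_space D)"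
proof -
  let ?u = "indicator D :: complex^'n \<Rightarrow> complex"
  note u = indicator_in_bergman_space[OF D(1,2)]
  have u0: "?u w0 = 1" using D(3) by simp
  have F: "friedrichs_operator D g = fun_scale (cnj (g w0)) ?u" if "g \<in> bergman_space D" for g
    using friedrichs_operator_of_quadrature[OF D quad that] .
  interpret VS: vector_space "fun_scale :: complex \<Rightarrow> (complex^'n \<Rightarrow> complex) \<Rightarrow> _"
    by (rule vector_space_fun_scale)
  have "friedrichs_operator D ` bergman_space D = VS.span {?u}"
    unfolding VS.span_singleton
  proof (intro equalityI subsetI)
    fix f assume "f \<in> range (\<lambda>k. fun_scale k ?u)"
    then obtain c where c: "f = fun_scale c ?u" by blast
    have "(\<lambda>z. (cnj c + 1) * ?u z - ?u z) \<in> bergman_space D" by (rule bergman_space_diff_cmult[OF D(1) u(1) u(1)])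
    moreover have "friedrichs_operator D (\<lambda>z. (cnj c + 1) * ?u z - ?u z) = f"
      unfolding c F[OF calculation] by (simp add: u0)
    ultimately show "f \<in> friedrichs_operator D ` bergman_space D" by blast
  qed (use F in auto)
  moreover have "?u \<noteq> 0" using u0 by (auto simp: fun_eq_iff intro!: exI[of _ w0])
  then have "VS.independent {?u}" by (simp add: VS.dependent_single)
  ultimately show ?thesis
    unfolding rank_one_on_def by (simp add: VS.dim_eq_card_independent)
qed

theorem theorem3p7:
  fixes D\<^sub>1 D\<^sub>2 :: "(complex^'n) set" and \<phi> :: "complex^'n \<Rightarrow> complex^'n"
    and m d :: nat and p :: "complex^'n \<Rightarrow> complex"
  assumes "complex_domain D\<^sub>1" and "bounded D\<^sub>1"
    and "complex_domain D\<^sub>2" and "bounded D\<^sub>2"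
    and "proper_holomorphic_map D\<^sub>1 D\<^sub>2 \<phi>" and "has_multiplicity D\<^sub>1 D\<^sub>2 \<phi> m"
    and "circular D\<^sub>1" and "0 \<in> D\<^sub>1"
    and "homogeneous_polynomial d p" and "\<forall>z\<in>D\<^sub>1. complex_jacobian \<phi> z = p z"
  shows "rank_one_on (friedrichs_operator D\<^sub>2) (bergman_space D\<^sub>2)"
proof -
  have D1: "open D\<^sub>1" "connected D\<^sub>1" "D\<^sub>1 \<noteq> {}" and D2: "open D\<^sub>2"
    using assms(1,3) by (auto simp: complex_domain_def)
  have h: "holomorphic_map_on \<phi> D\<^sub>1" and \<phi>: "\<phi> \<in> D\<^sub>1 \<rightarrow> D\<^sub>2"
    using assms(5) by (auto simp: proper_holomorphic_map_def)
  define w0 where "w0 = \<phi> 0"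
  have w0: "w0 \<in> D\<^sub>2" using \<phi> assms(8) by (auto simp: w0_def)
  let ?A = "bergman_space D\<^sub>2"
  let ?W = "\<lambda>z. (cmod (complex_jacobian \<phi> z))\<^sup>2"
  define V where "V = (\<integral>z. (1::complex) \<partial>borel_on D\<^sub>2)"
  define I where "I = (\<integral>z. ?W z \<partial>borel_on D\<^sub>1)"
  note A = bergman_spaceD[OF D2]
  note u = indicator_in_bergman_space[OF D2 assms(4)]
  note cov = change_of_variables_multiplicity[OF h D1(1) \<phi> D2 assms(6)]
  have cW: "continuous_on D\<^sub>1 ?W"
    by (intro continuous_intros continuous_on_complex_jacobian[OF h D1(1)])
  have iW: "integrable (borel_on D\<^sub>1) ?W"
    using integrable_norm[OF cov(1)[OF u(2)]] by simp
  have Wrot: "?W (cis \<theta> *s z) = ?W z" if "z \<in> D\<^sub>1" for z \<theta>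
    using that circular_cis[OF assms(7) that] assms(10)
    by (simp add: homogeneous_polynomial_smult[OF assms(9)] norm_mult norm_power)
  have I0: "I \<noteq> 0"
  proof
    assume "I = 0"
    then have "?W z = 0" if "z \<in> D\<^sub>1" for z
      using continuous_integral_zero_imp_zero[OF D1(1) cW _ iW _ that] by (simp add: I_def)
    then show False
      using proper_holomorphic_map_jacobian_nonzero[OF assms(5) D1(1,3)] by auto
  qed
  have mV: "of_nat m * V = of_real I"
    using cov(2)[OF u(2)] unfolding V_def I_def
    by (simp only: scaleR_conv_of_real mult_1_right integral_complex_of_real)
  have quad: "(\<integral>z. f z * g z \<partial>borel_on D\<^sub>2) = V * (f w0 * g w0)"
    if f: "f \<in> ?A" and g: "g \<in> ?A" for f g
  proof -
    have int: "integrable (borel_on D\<^sub>2) (\<lambda>z. f z * g z)"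
      using A[OF f] A[OF g] by (intro integrable_product_L2) auto
    have "of_nat m * (\<integral>z. f z * g z \<partial>borel_on D\<^sub>2) = (\<integral>z. ?W z *\<^sub>R (f (\<phi> z) * g (\<phi> z)) \<partial>borel_on D\<^sub>1)"
      by (rule cov(2)[OF int, symmetric])
    also have "\<dots> = of_real I * (f w0 * g w0)"
      unfolding I_def w0_def
      by (intro integral_circular_weight[OF D1(1,2) assms(7,8) _ cW Wrot] cov(1)[OF int]
          holomorphic_fun_on_compose_map[OF holomorphic_fun_on_mult[OF A(1)[OF f] A(1)[OF g]] h \<phi>]) 
    also have "\<dots> = of_nat m * (V * (f w0 * g w0))" using mV by simp
    finally show "(\<integral>z. f z * g z \<partial>borel_on D\<^sub>2) = V * (f w0 * g w0)"
      using mV I0 by auto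
  qed
  show ?thesis
    using rank_one_of_quadrature[OF D2 assms(4) w0 quad] .
qed

end
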